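(* Let $A=(A_1\;\;A_2)\in\mathbb{R}^{m\times n}$ with $A_1\in\mathbb{R}^{m\times k}$ of rank $k$ and $A_2\in\mathbb{R}^{m\times(n-k)}$, and let $k\le r\le\min\{m,n\}$. Let $\sigma_1\ge\sigma_2\ge\cdots\ge\sigma_s>0$ be the nonzero singular values of $P_{A_1}^{\perp}(A_2)$, and suppose that $\sigma_{r-k}>\sigma_{r-k+1}$. Let $W_2=\mathbbm{1}$ and, for a weight matrix $W_1\in\mathbb{R}^{m\times k}$ with positive entries, let $(\tilde X_1(W)\;\;\tilde X_2(W))$ be a solution of $$\min_{\substack{X_1\in\mathbb{R}^{m\times k},\,X_2\in\mathbb{R}^{m\times(n-k)}\\ \operatorname{rank}(X_1\;\;X_2)\le r}}\big\|\big((A_1\;\;A_2)-(X_1\;\;X_2)\big)\odot(W_1\;\;W_2)\big\|_F^2 .$$ Put $\lambda=\min_{1\le i\le m,\,1\le j\le k}(W_1)_{ij}$. Then, as $\lambda\to\infty$, $$(\tilde X_1(W)\;\;\tilde X_2(W))=A_G+O\Big(\frac1\lambda\Big),$$ where $A_G=(A_1\;\;\tilde A_2)$ is the unique solution of $$\min_{\substack{X_1,X_2\\ \operatorname{rank}(X_1\;\;X_2)\le r\\ X_1=A_1}}\|(A_1\;\;A_2)-(X_1\;\;X_2)\|_F^2 .$$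
   Context: $\|\cdot\|_F$ is the Frobenius norm, $\odot$ is the Hadamard (entrywise) product, and $\mathbbm{1}$ is the matrix (of the appropriate size) all of whose entries equal $1$. $P_{A_1}$ and $P_{A_1}^{\perp}$ denote the orthogonal projections onto the column space of $A_1$ and onto its orthogonal complement, applied to matrices columnwise. Conventions: $\sigma_0:=\infty$ and $\sigma_j:=0$ for $j>s$. The matrices $A_1,A_2$ and the integers $r,k$ are fixed; $O(1/\lambda)$ denotes a matrix whose norm is bounded by $C/\lambda$ for all sufficiently large $\lambda$, with $C$ independent of $W_1$. *)

theory Defs
  imports
    "Jordan_Normal_Form.Char_Poly"
    "Jordan_Normal_Form.DL_Rank"
    "HOL-Library.Extended_Real"
begin

definition append_cols :: "'a mat \<Rightarrow> 'a mat \<Rightarrow> 'a mat" where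
  "append_cols A B = mat_of_cols (dim_row A) (cols A @ cols B)"

definition hadamard :: "'a :: times mat \<Rightarrow> 'a mat \<Rightarrow> 'a mat" (infixl "\<odot>\<^sub>H" 70) where
  "A \<odot>\<^sub>H B = mat (dim_row A) (dim_col A) (\<lambda>(i, j). A $$ (i, j) * B $$ (i, j))"

definition frob_norm :: "real mat \<Rightarrow> real" where
  "frob_norm A = sqrt (\<Sum>i<dim_row A. \<Sum>j<dim_col A. (A $$ (i, j))\<^sup>2)"

definition all_ones :: "nat \<Rightarrow> nat \<Rightarrow> real mat" where
  "all_ones nr nc = mat nr nc (\<lambda>_. 1)"

(* Only meaningful for a linear subspace S of the space containing v; then the
   described vector exists and is unique. *)
definition orth_proj :: "real vec set \<Rightarrow> real vec \<Rightarrow> real vec" where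
  "orth_proj S v = (THE p. p \<in> S \<and> (\<forall>u\<in>S. (v - p) \<bullet> u = 0))"

definition proj_perp :: "real mat \<Rightarrow> real mat \<Rightarrow> real mat" where
  "proj_perp A B = mat_of_cols (dim_row A)
     (map (orth_proj (vec_module.orthogonal_complement (dim_row A)
             (vec_space.col_space (dim_row A) A)))
       (cols B))"

(* The square roots of the nonzero eigenvalues of B^T B, with multiplicity, in
   decreasing order.  B^T B is symmetric, so its characteristic polynomial has
   only real roots and proots misses none. *)
definition nonzero_singular_values :: "real mat \<Rightarrow> real list" where
  "nonzero_singular_values B =
     rev (sorted_list_of_multiset
       (image_mset sqrt (filter_mset (\<lambda>x. x \<noteq> 0) (proots (char_poly (B\<^sup>T * B))))))"

(* Indexed from 1, with the conventions sigma_0 = infinity and sigma_j = 0 beyond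
   the last nonzero singular value. *)
definition sing_val :: "real mat \<Rightarrow> nat \<Rightarrow> ereal" where
  "sing_val B j =
     (if j = 0 then \<infinity>
      else if j \<le> length (nonzero_singular_values B)
      then ereal (nonzero_singular_values B ! (j - 1))
      else 0)"

definition low_rank_pairs :: "nat \<Rightarrow> nat \<Rightarrow> nat \<Rightarrow> nat \<Rightarrow> (real mat \<times> real mat) set" where
  "low_rank_pairs m k l r =
     {(X\<^sub>1, X\<^sub>2). X\<^sub>1 \<in> carrier_mat m k \<and> X\<^sub>2 \<in> carrier_mat m l \<and>
        vec_space.rank m (append_cols X\<^sub>1 X\<^sub>2) \<le> r}"

definition weighted_cost ::
  "real mat \<Rightarrow> real mat \<Rightarrow> real mat \<Rightarrow> real mat \<Rightarrow> real mat \<times> real mat \<Rightarrow> real" where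
  "weighted_cost A\<^sub>1 A\<^sub>2 W\<^sub>1 W\<^sub>2 = (\<lambda>(X\<^sub>1, X\<^sub>2).
     (frob_norm ((append_cols A\<^sub>1 A\<^sub>2 - append_cols X\<^sub>1 X\<^sub>2) \<odot>\<^sub>H append_cols W\<^sub>1 W\<^sub>2))\<^sup>2)"

definition plain_cost :: "real mat \<Rightarrow> real mat \<Rightarrow> real mat \<times> real mat \<Rightarrow> real" where
  "plain_cost A\<^sub>1 A\<^sub>2 = (\<lambda>(X\<^sub>1, X\<^sub>2).
     (frob_norm (append_cols A\<^sub>1 A\<^sub>2 - append_cols X\<^sub>1 X\<^sub>2))\<^sup>2)"

definition min_entry :: "real mat \<Rightarrow> real" where
  "min_entry W = Min {W $$ (i, j) | i j. i < dim_row W \<and> j < dim_col W}"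

end

theory Submission
  imports Defs "Jordan_Normal_Form.Schur_Decomposition" "HOL-Analysis.L2_Norm"
begin

text \<open>
  Let \<open>B\<close> be the projection of \<open>A\<^sub>2\<close> onto the complement of the columns of \<open>A\<^sub>1\<close>, and \<open>H\<close> its
  singular value truncation to rank \<open>q = r - k\<close>. The constrained problem satisfies a global quadratic
  growth condition
  \<open>\<parallel>A\<^sub>2 - Z\<parallel>\<^sup>2 \<ge> \<parallel>A\<^sub>2 - A\<^sub>2'\<parallel>\<^sup>2 + c \<parallel>Z - A\<^sub>2'\<parallel>\<^sup>2\<close>: apply the Eckart--Young inequality to the matrix
  \<open>H + t (B - H)\<close>, which for some \<open>t > 1\<close> still has \<open>H\<close> as a best approximation because of the gap
  in the singular values; this gives \<open>c = 1 - 1 / t\<close>.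

  Comparing a weighted minimiser with \<open>(A\<^sub>1 A\<^sub>2')\<close> shows \<open>\<parallel>X\<^sub>1 - A\<^sub>1\<parallel> = O(1 / \<lambda>)\<close>, so \<open>X\<^sub>1 = S A\<^sub>1\<close>
  for some invertible \<open>S = 1 + O(1 / \<lambda>)\<close>. Then \<open>S\<^sup>-\<^sup>1 X\<^sub>2\<close> is feasible for the constrained problem
  and \<open>S A\<^sub>2'\<close> is a competitor of \<open>X\<^sub>2\<close>; quadratic growth turns the resulting inequality into
  \<open>\<parallel>S\<^sup>-\<^sup>1 X\<^sub>2 - A\<^sub>2'\<parallel> = O(1 / \<lambda>)\<close>.
\<close>

section \<open>Orthogonal diagonalization of real symmetric matrices\<close>

text \<open>The delicate point is the linear rate. Quadratic growth together with a cost excess of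
  order 1 / \<lambda> yields only a distance of order 1 / sqrt \<lambda>. For this reason the
  competitor keeps the first block of the minimiser and distorts the limit by the same
  \<open>S\<close>. Both sides of the comparison then contain the same first-order term, which
  cancels, and every term left over carries a factor
  \<open>S\<^sup>-\<^sup>1 X\<^sub>2 - A\<^sub>2'\<close> that can be divided out. Sharing the first
  block also cancels the weighted terms, so \<open>W\<^sub>1\<close> acts only through the bound on
  \<open>X\<^sub>1 - A\<^sub>1\<close>, and the constants are uniform in \<open>W\<^sub>1\<close>.

  Matrices of bounded rank do not form a convex set, so first-order optimality of \<open>H\<close>
  would not give a global estimate. Optimality of \<open>H\<close> for the stretched matrix replaces
  convexity: it bounds from below the inner product of \<open>B - H\<close> with
  \<open>H - Y\<close> for every feasible \<open>Y\<close>, near or far.\<close>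

lemma orthogonal_mat_with_first_col:
  fixes v :: "real vec"
  assumes v: "v \<in> carrier_vec (Suc n)" and unit: "v \<bullet> v = 1"
  shows "\<exists>W \<in> carrier_mat (Suc n) (Suc n). W\<^sup>T * W = 1\<^sub>m (Suc n) \<and> col W 0 = v"
proof (cases "v = unit_vec (Suc n) 0")
  case True
  then show ?thesis
    by (intro bexI[of _ "1\<^sub>m (Suc n)"]) auto
next
  case False
  \<comment> \<open>the Householder reflection exchanging \<open>v\<close> and the first unit vector\<close>
  define w where "w i = v $ i - (if i = 0 then 1 else 0)" for i
  \<comment> \<open>Equal to 2 / (w . w): since v . v = 1, one has w . w = 2 (1 - v_0). A unit
    vector with v_0 = 1 is the first unit vector, which this case excludes.\<close>
  define c where "c = 1 / (1 - v $ 0)"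
  define d :: "nat \<Rightarrow> nat \<Rightarrow> real" where "d i j = (if i = j then 1 else 0)" for i j
  define W where "W = mat (Suc n) (Suc n) (\<lambda>(i, j). d i j - c * w i * w j)"
  have vv: "(\<Sum>i<Suc n. v $ i * v $ i) = 1"
    using unit v by (simp add: scalar_prod_def lessThan_atLeast0)
  have v0: "v $ 0 \<noteq> 1"
  proof
    assume v0: "v $ 0 = 1"
    then have "(\<Sum>i<n. v $ Suc i * v $ Suc i) = 0"
      using vv by (simp add: sum.lessThan_Suc_shift del: sum.lessThan_Suc)
    then have "v $ Suc i = 0" if "i < n" for i
      using that by (subst (asm) sum_nonneg_eq_0_iff) auto
    then have "v = unit_vec (Suc n) 0"
      using v v0 by (intro eq_vecI) (auto simp: less_Suc_eq_0_disj)
    then show False using False by simp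
  qed
  have "(\<Sum>i<Suc n. w i * w i) = (\<Sum>i<Suc n. v $ i * v $ i) - 2 * v $ 0 + 1"
    by (simp add: w_def sum.lessThan_Suc_shift algebra_simps del: sum.lessThan_Suc)
  then have ww: "c * (\<Sum>i<Suc n. w i * w i) = 2"
    using v0 unfolding vv c_def by (simp add: field_simps)
  have W: "W \<in> carrier_mat (Suc n) (Suc n)" by (simp add: W_def)
  have dl: "(\<Sum>k<Suc n. d k i * f k) = f i" if "i < Suc n" for f :: "nat \<Rightarrow> real" and i
  proof -
    have "(\<Sum>k<Suc n. d k i * f k) = (\<Sum>k<Suc n. if k = i then f k else 0)"
      by (intro sum.cong) (auto simp: d_def)
    then show ?thesis using that by (simp del: sum.lessThan_Suc)
  qed
  have "(W\<^sup>T * W) $$ (i, j) = 1\<^sub>m (Suc n) $$ (i, j)" if i: "i < Suc n" and j: "j < Suc n" for i j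
  proof -
    have "(W\<^sup>T * W) $$ (i, j) = (\<Sum>k<Suc n. (d k i - c * w k * w i) * (d k j - c * w k * w j))"
      using i j W by (simp add: scalar_prod_def W_def lessThan_atLeast0)
    also have "\<dots> = (\<Sum>k<Suc n. d k i * d k j - d k i * (c * w k * w j) - d k j * (c * w k * w i)
        + (c * w i * w j) * c * (w k * w k))"
      by (intro sum.cong) (auto simp: algebra_simps)
    also have "\<dots> = d i j - c * w i * w j - c * w j * w i
        + (c * w i * w j) * (c * (\<Sum>k<Suc n. w k * w k))"
      unfolding sum.distrib sum_subtractf dl[OF i] dl[OF j]
      by (simp add: sum_distrib_left mult.assoc del: sum.lessThan_Suc)
    also have "\<dots> = d i j" unfolding ww by simp
    finally show ?thesis using i j by (simp add: d_def)
  qed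
  then have "W\<^sup>T * W = 1\<^sub>m (Suc n)" using W by (intro eq_matI) auto
  moreover have "col W 0 = v"
  proof (rule eq_vecI)
    fix i assume "i < dim_vec v"
    then have i: "i < Suc n" using v by simp
    have "c * w 0 = -1" using v0 by (simp add: c_def w_def divide_simps)
    then have "c * w i * w 0 = - w i"
      by (metis mult.commute mult.left_commute mult_minus1_right)
    then show "col W 0 $ i = v $ i"
      using i by (simp add: W_def d_def) (simp add: w_def)
  qed (use v W in simp)
  ultimately show ?thesis using W by blast
qed

text \<open>Over the complex numbers the polynomial splits anyway, so only the reality of its roots
  is at stake. If w is an eigenvector for the root a, the form w* A w equals a times the positive
  number w* w, and it is its own conjugate because A is real and symmetric. Injectivity of the
  embedding of real polynomials then brings the factorization back.\<close>

lemma char_poly_symmetric_splits: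
  fixes A :: "real mat"
  assumes A: "A \<in> carrier_mat n n" and sym: "A\<^sup>T = A"
  shows "\<exists>es. char_poly A = (\<Prod>e\<leftarrow>es. [:- e, 1:])"
proof -
  interpret hp: map_poly_inj_idom_hom "of_real :: real \<Rightarrow> complex" ..
  define M where "M = map_mat complex_of_real A"
  have M: "M \<in> carrier_mat n n" using A by (simp add: M_def)
  obtain as where as: "char_poly M = (\<Prod>a\<leftarrow>as. [:- a, 1:])"
    using char_poly_factorized[OF M] by blast
  have real: "a = of_real (Re a)" if "a \<in> set as" for a
  proof -
    have "poly (char_poly M) a = 0"
      using that unfolding as poly_prod_list by (force simp: prod_list_zero_iff)
    then have "eigenvalue M a" using eigenvalue_root_char_poly[OF M] by simp
    then obtain w where w: "w \<in> carrier_vec n" "w \<noteq> 0\<^sub>v n" and ev: "M *\<^sub>v w = a \<cdot>\<^sub>v w"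
      using M unfolding eigenvalue_def eigenvector_def by auto
    have ev_i: "(\<Sum>j<n. of_real (A $$ (i, j)) * w $ j) = a * w $ i" if "i < n" for i
      using arg_cong[OF ev, of "\<lambda>v. v $ i"] that w A
      by (simp add: M_def scalar_prod_def lessThan_atLeast0)
    define s where "s = (\<Sum>i<n. \<Sum>j<n. cnj (w $ i) * (of_real (A $$ (i, j)) * w $ j))"
    define N where "N = (\<Sum>i<n. cnj (w $ i) * w $ i)"
    have "s = (\<Sum>i<n. cnj (w $ i) * (a * w $ i))"
      unfolding s_def by (intro sum.cong) (auto simp: ev_i simp flip: sum_distrib_left)
    then have "s = a * N" by (simp add: N_def sum_distrib_left mult_ac)
    moreover have "cnj s = s"
    proof -
      have "cnj s = (\<Sum>i<n. \<Sum>j<n. cnj (w $ j) * (of_real (A $$ (i, j)) * w $ i))"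
        by (simp add: s_def cnj_sum mult_ac)
      also have "\<dots> = (\<Sum>i<n. \<Sum>j<n. cnj (w $ j) * (of_real (A $$ (j, i)) * w $ i))"
      proof (intro sum.cong refl)
        fix i j assume "i \<in> {..<n}" "j \<in> {..<n}"
        then have "A $$ (i, j) = A $$ (j, i)"
          using sym A by (metis index_transpose_mat(1) carrier_matD lessThan_iff)
        then show "cnj (w $ j) * (of_real (A $$ (i, j)) * w $ i)
          = cnj (w $ j) * (of_real (A $$ (j, i)) * w $ i)" by simp
      qed
      also have "\<dots> = s" unfolding s_def by (rule sum.swap)
      finally show ?thesis .
    qed
    moreover have N: "N = of_real (\<Sum>i<n. (cmod (w $ i))\<^sup>2)"
      unfolding N_def of_real_sum complex_norm_square by (simp add: mult.commute)
    moreover have "N \<noteq> 0"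
    proof
      assume "N = 0"
      then have "(\<Sum>i<n. (cmod (w $ i))\<^sup>2) = 0" unfolding N by (simp only: of_real_eq_0_iff)
      then have "\<forall>i<n. w $ i = 0"
        by (subst (asm) sum_nonneg_eq_0_iff) auto
      then have "w = 0\<^sub>v n" using w by (intro eq_vecI) auto
      then show False using w by simp
    qed
    ultimately have "cnj a = a"
      by (metis complex_cnj_complex_of_real complex_cnj_mult mult_cancel_right)
    then show ?thesis
      by (metis Reals_cnj_iff of_real_Re)
  qed
  have "map_poly complex_of_real (char_poly A) = (\<Prod>a\<leftarrow>as. [:- a, 1:])"
    unfolding as[symmetric] M_def by (rule of_real_hom.char_poly_hom[OF A, symmetric])
  also have "\<dots> = (\<Prod>a\<leftarrow>as. map_poly of_real [:- Re a, 1:])"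
  proof -
    have "[:- a, 1:] = map_poly of_real [:- Re a, 1:]" if "a \<in> set as" for a
    proof -
      have "\<exists>b. a = complex_of_real b" using real[OF that] by blast
      then show ?thesis by auto
    qed
    then show ?thesis by (intro arg_cong[of _ _ prod_list] map_cong) auto
  qed
  also have "\<dots> = map_poly of_real (\<Prod>a\<leftarrow>as. [:- Re a, 1:])"
    by (simp add: hp.hom_prod_list o_def)
  finally have "char_poly A = (\<Prod>a\<leftarrow>as. [:- Re a, 1:])"
    by (simp only: hp.eq_iff)
  then have "char_poly A = (\<Prod>e\<leftarrow>map Re as. [:- e, 1:])" by (simp add: o_def)
  then show ?thesis by blast
qed

lemma transpose_mult_mult_entry:
  fixes A :: "'a :: comm_semiring_0 mat"
  assumes "A \<in> carrier_mat n n" "W \<in> carrier_mat n p" "i < p" "j < p"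
  shows "(W\<^sup>T * A * W) $$ (i, j) = col W i \<bullet> (A *\<^sub>v col W j)"
proof -
  have "W\<^sup>T * A * W = W\<^sup>T * (A * W)" using assms by (intro assoc_mult_mat) auto
  moreover have "(W\<^sup>T * (A * W)) $$ (i, j) = col W i \<bullet> col (A * W) j" using assms by simp
  ultimately show ?thesis using col_mult2[OF assms(1,2,4)] by simp
qed

text \<open>Deflation along the list of roots: a unit eigenvector for the head is completed to an
  orthogonal \<open>W\<close>, and symmetry clears the first row of \<open>W\<^sup>T * A * W\<close>
  along with its first column. The list is an input, so the caller chooses the order of the
  diagonal; for singular values it will be decreasing.\<close>

lemma spectral_theorem_symmetric:
  fixes A :: "real mat"
  assumes "A \<in> carrier_mat n n" and "A\<^sup>T = A"
    and "char_poly A = (\<Prod>e\<leftarrow>es. [:- e, 1:])"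
  shows "\<exists>U \<in> carrier_mat n n. U\<^sup>T * U = 1\<^sub>m n \<and> U\<^sup>T * A * U = mat_diag n (\<lambda>i. es ! i)"
  using assms
proof (induction es arbitrary: n A)
  case Nil
  then have "n = 0" using degree_monic_char_poly[of A n] by simp
  then show ?case using Nil by (intro bexI[of _ "1\<^sub>m n"] conjI eq_matI) (auto simp: mat_diag_def)
next
  case (Cons e es n A)
  have cp: "char_poly A = [:- e, 1:] * (\<Prod>e\<leftarrow>es. [:- e, 1:])" using Cons.prems by simp
  have mon: "monic (\<Prod>e\<leftarrow>es. [:- e, 1:])" by (rule monic_prod_list) auto
  have "degree (char_poly A) = Suc (degree (\<Prod>e\<leftarrow>es. [:- e, 1:]))"
    unfolding cp by (subst degree_mult_eq) (use mon in auto)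
  then obtain k where n: "n = Suc k"
    using degree_monic_char_poly[OF Cons.prems(1)] by (cases n) auto
  have A: "A \<in> carrier_mat (Suc k) (Suc k)" using Cons.prems n by simp
  have "eigenvalue A e" unfolding eigenvalue_root_char_poly[OF A] cp by simp
  then obtain w where w: "w \<in> carrier_vec (Suc k)" "w \<noteq> 0\<^sub>v (Suc k)" "A *\<^sub>v w = e \<cdot>\<^sub>v w"
    using A unfolding eigenvalue_def eigenvector_def by auto
  define v where "v = (1 / sqrt (w \<bullet> w)) \<cdot>\<^sub>v w"
  have v: "v \<in> carrier_vec (Suc k)" using w by (simp add: v_def)
  have ww: "w \<bullet> w > 0"
    using conjugate_square_greater_0_vec[OF w(1)] w(2) by (simp add: conjugate_vec_def) 
  have vv: "v \<bullet> v = 1" using w ww by (simp add: v_def)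
  have Av: "A *\<^sub>v v = e \<cdot>\<^sub>v v"
    using w A by (simp add: v_def mult_mat_vec smult_smult_assoc mult.commute)
  obtain W where W: "W \<in> carrier_mat (Suc k) (Suc k)" and WW: "W\<^sup>T * W = 1\<^sub>m (Suc k)"
    and W0: "col W 0 = v"
    using orthogonal_mat_with_first_col[OF v vv] by blast
  have WW': "W * W\<^sup>T = 1\<^sub>m (Suc k)" using mat_mult_left_right_inverse[OF _ W WW] W by simp
  define A' where "A' = W\<^sup>T * A * W"
  have A': "A' \<in> carrier_mat (Suc k) (Suc k)" using W A by (simp add: A'_def)
  have symA': "A'\<^sup>T = A'"
    using W A Cons.prems(2)
    by (simp add: A'_def transpose_mult[of _ "Suc k" "Suc k" _ "Suc k"] assoc_mult_mat[of _ "Suc k" "Suc k" _ "Suc k" _ "Suc k"])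
  have col0: "A' $$ (i, 0) = (if i = 0 then e else 0)" if i: "i < Suc k" for i
  proof -
    have "A' $$ (i, 0) = e * (col W i \<bullet> col W 0)"
      unfolding A'_def transpose_mult_mult_entry[OF A W i zero_less_Suc] W0 Av using W v i by simp
    also have "col W i \<bullet> col W 0 = (W\<^sup>T * W) $$ (i, 0)" using W i by simp
    finally show ?thesis using i unfolding WW by simp
  qed
  have row0: "A' $$ (0, i) = (if i = 0 then e else 0)" if i: "i < Suc k" for i
    using col0[OF i] symA' A' i by (metis carrier_matD index_transpose_mat(1) zero_less_Suc)
  define E where "E = mat 1 1 (\<lambda>_. e)"
  define A3 where "A3 = mat k k (\<lambda>(i, j). A' $$ (Suc i, Suc j))"
  have E: "E \<in> carrier_mat 1 1" and A3: "A3 \<in> carrier_mat k k" by (auto simp: E_def A3_def)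
  have A'block: "A' = four_block_mat E (0\<^sub>m 1 k) (0\<^sub>m k 1) A3"
    by (rule eq_matI) (use A' col0 row0 in \<open>auto simp: E_def A3_def\<close>)
  have "similar_mat A' A"
    unfolding similar_mat_def
    by (intro exI[of _ "W\<^sup>T"] exI[of _ W] similar_mat_witI[of _ _ "Suc k"])
      (use W A A' WW WW' in \<open>auto simp: A'_def\<close>)
  then have "char_poly A' = [:- e, 1:] * (\<Prod>e\<leftarrow>es. [:- e, 1:])"
    using char_poly_similar cp by metis
  also have "char_poly A' = char_poly E * char_poly A3"
    unfolding A'block by (rule char_poly_four_block_zeros_col[OF E _ A3]) simp
  also have "char_poly E = [:- e, 1:]"
    by (simp add: E_def char_poly_defs det_def sign_def)
  finally have cp3: "char_poly A3 = (\<Prod>e\<leftarrow>es. [:- e, 1:])"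
    by (metis mult_cancel_left pCons_eq_0_iff zero_neq_one)
  have sym3: "A3\<^sup>T = A3"
  proof (rule eq_matI)
    fix i j assume "i < dim_row A3" "j < dim_col A3"
    then have "i < k" "j < k" by (auto simp: A3_def)
    then show "A3\<^sup>T $$ (i, j) = A3 $$ (i, j)"
      using symA' A' by (simp add: A3_def) (metis carrier_matD index_transpose_mat(1) Suc_less_eq)
  qed (auto simp: A3_def)
  obtain U where U: "U \<in> carrier_mat k k" and UU: "U\<^sup>T * U = 1\<^sub>m k"
    and UA: "U\<^sup>T * A3 * U = mat_diag k (\<lambda>i. es ! i)"
    using Cons.IH[OF A3 sym3 cp3] by blast
  define V where "V = four_block_mat (1\<^sub>m 1) (0\<^sub>m 1 k) (0\<^sub>m k 1) U"
  have V: "V \<in> carrier_mat (Suc k) (Suc k)" using U by (auto simp: V_def)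
  have VT: "V\<^sup>T = four_block_mat (1\<^sub>m 1) (0\<^sub>m 1 k) (0\<^sub>m k 1) (U\<^sup>T)"
    unfolding V_def using U by (subst transpose_four_block_mat[of _ 1 1 _ k _ k]) auto
  have VV: "V\<^sup>T * V = 1\<^sub>m (Suc k)"
    using U UU by (subst VT, subst V_def, subst mult_four_block_mat[of _ 1 1 _ k _ k _ _ 1 _ k]) auto
  have VAV: "V\<^sup>T * A' * V = mat_diag (Suc k) (\<lambda>i. (e # es) ! i)"
  proof -
    have "V\<^sup>T * A' = four_block_mat E (0\<^sub>m 1 k) (0\<^sub>m k 1) (U\<^sup>T * A3)"
      unfolding VT A'block using U E A3
      by (subst mult_four_block_mat[of _ 1 1 _ k _ k _ _ 1 _ k]) auto
    then have "V\<^sup>T * A' * V = four_block_mat E (0\<^sub>m 1 k) (0\<^sub>m k 1) (U\<^sup>T * A3 * U)"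
      unfolding V_def using U E A3
      by simp (subst mult_four_block_mat[of _ 1 1 _ k _ k _ _ 1 _ k], auto)
    also have "\<dots> = mat_diag (Suc k) (\<lambda>i. (e # es) ! i)"
      unfolding UA by (rule eq_matI) (auto simp: E_def mat_diag_def)
    finally show ?thesis .
  qed
  note ac = assoc_mult_mat[of _ "Suc k" "Suc k" _ "Suc k" _ "Suc k"]
  show ?case unfolding n
  proof (intro bexI[of _ "W * V"] conjI)
    have "(W * V)\<^sup>T * (W * V) = V\<^sup>T * (W\<^sup>T * W) * V"
      using W V by (simp add: transpose_mult[OF W V] ac)
    then show "(W * V)\<^sup>T * (W * V) = 1\<^sub>m (Suc k)" using V VV WW by simp
    have "(W * V)\<^sup>T * A * (W * V) = V\<^sup>T * A' * V"
      using W V A by (simp add: transpose_mult[OF W V] A'_def ac)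
    then show "(W * V)\<^sup>T * A * (W * V) = mat_diag (Suc k) (\<lambda>i. (e # es) ! i)" using VAV by simp
  qed (use W V in simp)
qed

section \<open>Frobenius inner product\<close>

definition fip :: "real mat \<Rightarrow> real mat \<Rightarrow> real" where
  "fip A B = (\<Sum>i<dim_row A. \<Sum>j<dim_col A. A $$ (i, j) * B $$ (i, j))"

lemma frob_norm_square: "(frob_norm A)\<^sup>2 = fip A A"
  unfolding frob_norm_def fip_def by (subst real_sqrt_pow2) (auto intro!: sum_nonneg simp: power2_eq_square)

lemma frob_norm_nonneg [simp]: "0 \<le> frob_norm A"
  unfolding frob_norm_def by (auto intro!: sum_nonneg)

lemma frob_norm_L2_set:
  "frob_norm A = L2_set (\<lambda>(i, j). A $$ (i, j)) ({..<dim_row A} \<times> {..<dim_col A})"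
  unfolding frob_norm_def L2_set_def by (simp add: sum.cartesian_product case_prod_unfold)

lemma fip_commute: "A \<in> carrier_mat m n \<Longrightarrow> B \<in> carrier_mat m n \<Longrightarrow> fip A B = fip B A"
  unfolding fip_def by (simp add: mult.commute)

lemma fip_add_left:
  "A \<in> carrier_mat m n \<Longrightarrow> B \<in> carrier_mat m n \<Longrightarrow> fip (A + B) C = fip A C + fip B C"
  unfolding fip_def by (simp add: sum.distrib algebra_simps)

lemma fip_add_right:
  "A \<in> carrier_mat m n \<Longrightarrow> B \<in> carrier_mat m n \<Longrightarrow> C \<in> carrier_mat m n
    \<Longrightarrow> fip C (A + B) = fip C A + fip C B"
  unfolding fip_def by (simp add: sum.distrib algebra_simps)

lemma fip_diff_left:
  "A \<in> carrier_mat m n \<Longrightarrow> B \<in> carrier_mat m n \<Longrightarrow> fip (A - B) C = fip A C - fip B C"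
  unfolding fip_def by (simp add: sum_subtractf algebra_simps)

lemma fip_diff_right:
  "A \<in> carrier_mat m n \<Longrightarrow> B \<in> carrier_mat m n \<Longrightarrow> C \<in> carrier_mat m n
    \<Longrightarrow> fip C (A - B) = fip C A - fip C B"
  unfolding fip_def by (simp add: sum_subtractf algebra_simps)

lemma fip_smult_left: "fip (c \<cdot>\<^sub>m A) B = c * fip A B" if "A \<in> carrier_mat m n"
  using that unfolding fip_def by (simp add: sum_distrib_left mult.assoc)

lemma fip_smult_right:
  "A \<in> carrier_mat m n \<Longrightarrow> B \<in> carrier_mat m n \<Longrightarrow> fip A (c \<cdot>\<^sub>m B) = c * fip A B"
  unfolding fip_def by (simp add: sum_distrib_left mult_ac)

lemma fip_mult_left:
  assumes "A \<in> carrier_mat m n" "B \<in> carrier_mat n p" "C \<in> carrier_mat m p"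
  shows "fip (A * B) C = fip B (A\<^sup>T * C)"
proof -
  have "fip (A * B) C = (\<Sum>i<m. \<Sum>j<p. \<Sum>k<n. A $$ (i, k) * B $$ (k, j) * C $$ (i, j))"
    using assms by (simp add: fip_def scalar_prod_def lessThan_atLeast0 sum_distrib_right)
  also have "\<dots> = (\<Sum>i<m. \<Sum>k<n. \<Sum>j<p. A $$ (i, k) * B $$ (k, j) * C $$ (i, j))"
    by (intro sum.cong refl sum.swap)
  also have "\<dots> = (\<Sum>k<n. \<Sum>i<m. \<Sum>j<p. A $$ (i, k) * B $$ (k, j) * C $$ (i, j))"
    by (rule sum.swap)
  also have "\<dots> = (\<Sum>k<n. \<Sum>j<p. \<Sum>i<m. A $$ (i, k) * B $$ (k, j) * C $$ (i, j))"
    by (intro sum.cong refl sum.swap)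
  also have "\<dots> = fip B (A\<^sup>T * C)"
    using assms by (simp add: fip_def scalar_prod_def lessThan_atLeast0 sum_distrib_left mult_ac)
  finally show ?thesis .
qed

text \<open>Transports estimates between \<open>B\<close> and \<open>B * U\<close>: the growth
  inequality is proved where the Gram matrix is diagonal and then carried back. The inner sums
  collapse by \<open>U * U\<^sup>T = 1\<^sub>m n\<close>.\<close>

lemma fip_mult_orthogonal:
  assumes A: "A \<in> carrier_mat m n" and U: "U \<in> carrier_mat n n" and UU: "U\<^sup>T * U = 1\<^sub>m n"
  shows "fip (A * U) (A * U) = fip A A"
proof -
  have "U * U\<^sup>T = 1\<^sub>m n" using mat_mult_left_right_inverse[OF _ U UU] U by simp
  then have id: "(\<Sum>k<n. U $$ (a, k) * U $$ (b, k)) = (if a = b then 1 else 0)"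
    if "a < n" "b < n" for a b
  proof -
    have "(U * U\<^sup>T) $$ (a, b) = (\<Sum>k<n. U $$ (a, k) * U $$ (b, k))"
      using U that by (simp add: scalar_prod_def lessThan_atLeast0)
    then show ?thesis using that \<open>U * U\<^sup>T = _\<close> by simp
  qed
  have "(\<Sum>k<n. (\<Sum>a<n. A $$ (i, a) * U $$ (a, k)) * (\<Sum>b<n. A $$ (i, b) * U $$ (b, k)))
    = (\<Sum>a<n. A $$ (i, a) * A $$ (i, a))" for i
  proof -
    have "(\<Sum>k<n. (\<Sum>a<n. A $$ (i, a) * U $$ (a, k)) * (\<Sum>b<n. A $$ (i, b) * U $$ (b, k)))
      = (\<Sum>k<n. \<Sum>a<n. \<Sum>b<n. A $$ (i, a) * A $$ (i, b) * (U $$ (a, k) * U $$ (b, k)))"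
      by (simp add: sum_product mult_ac)
    also have "\<dots> = (\<Sum>a<n. \<Sum>k<n. \<Sum>b<n. A $$ (i, a) * A $$ (i, b) * (U $$ (a, k) * U $$ (b, k)))"
      by (rule sum.swap)
    also have "\<dots> = (\<Sum>a<n. \<Sum>b<n. \<Sum>k<n. A $$ (i, a) * A $$ (i, b) * (U $$ (a, k) * U $$ (b, k)))"
      by (intro sum.cong refl sum.swap)
    also have "\<dots> = (\<Sum>a<n. \<Sum>b<n. A $$ (i, a) * A $$ (i, b) * (if a = b then 1 else 0))"
      by (intro sum.cong refl) (simp add: id flip: sum_distrib_left)
    also have "\<dots> = (\<Sum>a<n. A $$ (i, a) * A $$ (i, a))"
      by (intro sum.cong refl) (simp add: if_distrib cong: if_cong)
    finally show ?thesis .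
  qed
  then show ?thesis
    using A U by (simp add: fip_def scalar_prod_def lessThan_atLeast0)
qed

lemma fip_columns:
  assumes "A \<in> carrier_mat m n"
  shows "fip A A = (\<Sum>j<n. (A\<^sup>T * A) $$ (j, j))"
proof -
  have "fip A A = (\<Sum>j<n. \<Sum>i<m. A $$ (i, j) * A $$ (i, j))"
    using assms unfolding fip_def by simp (rule sum.swap)
  then show ?thesis using assms by (simp add: scalar_prod_def lessThan_atLeast0)
qed

lemma fip_Cauchy_Schwarz:
  assumes "A \<in> carrier_mat m n" "B \<in> carrier_mat m n"
  shows "\<bar>fip A B\<bar> \<le> frob_norm A * frob_norm B"
proof -
  let ?a = "\<lambda>(i, j). A $$ (i, j)" and ?b = "\<lambda>(i, j). B $$ (i, j)" and ?S = "{..<m} \<times> {..<n}"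
  have "fip A B = (\<Sum>x\<in>?S. ?a x * ?b x)"
    using assms by (simp add: fip_def sum.cartesian_product case_prod_unfold)
  also have "\<bar>\<dots>\<bar> \<le> (\<Sum>x\<in>?S. \<bar>?a x\<bar> * \<bar>?b x\<bar>)"
    by (rule order_trans[OF sum_abs]) (simp add: abs_mult)
  also have "\<dots> \<le> L2_set ?a ?S * L2_set ?b ?S" by (rule L2_set_mult_ineq)
  finally show ?thesis using assms by (simp add: frob_norm_L2_set)
qed

lemma frob_norm_triangle:
  assumes "A \<in> carrier_mat m n" "B \<in> carrier_mat m n"
  shows "frob_norm (A + B) \<le> frob_norm A + frob_norm B"
proof -
  have "frob_norm (A + B) = L2_set (\<lambda>x. (case x of (i, j) \<Rightarrow> A $$ (i, j)) + (case x of (i, j) \<Rightarrow> B $$ (i, j)))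
     ({..<m} \<times> {..<n})"
    using assms unfolding frob_norm_L2_set by (intro L2_set_cong) auto
  also have "\<dots> \<le> frob_norm A + frob_norm B"
    using assms L2_set_triangle_ineq by (simp add: frob_norm_L2_set)
  finally show ?thesis .
qed

lemma frob_norm_minus_commute:
  assumes "A \<in> carrier_mat m n" "B \<in> carrier_mat m n"
  shows "frob_norm (A - B) = frob_norm (B - A)"
  using assms by (simp add: frob_norm_def power2_commute)

lemma sum_mult_square_le:
  fixes f g :: "'a \<Rightarrow> real"
  shows "(\<Sum>k\<in>S. f k * g k)\<^sup>2 \<le> (\<Sum>k\<in>S. (f k)\<^sup>2) * (\<Sum>k\<in>S. (g k)\<^sup>2)"
proof -
  have "\<bar>\<Sum>k\<in>S. f k * g k\<bar> \<le> L2_set f S * L2_set g S"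
    using sum_abs[of "\<lambda>k. f k * g k" S] L2_set_mult_ineq[of f g S] by (simp add: abs_mult)
  then have "(\<Sum>k\<in>S. f k * g k)\<^sup>2 \<le> (L2_set f S * L2_set g S)\<^sup>2"
    by (metis abs_ge_zero power2_abs power_mono)
  also have "\<dots> = (\<Sum>k\<in>S. (f k)\<^sup>2) * (\<Sum>k\<in>S. (g k)\<^sup>2)"
    by (simp add: L2_set_def power_mult_distrib sum_nonneg)
  finally show ?thesis .
qed

text \<open>Cauchy-Schwarz bounds each squared entry of the product by a row factor times a column
  factor, and the double sum of these bounds splits.\<close>

lemma frob_norm_mult:
  assumes A: "A \<in> carrier_mat m n" and B: "B \<in> carrier_mat n p"
  shows "frob_norm (A * B) \<le> frob_norm A * frob_norm B"
proof -
  have "(\<Sum>i<m. \<Sum>j<p. (\<Sum>k<n. A $$ (i, k) * B $$ (k, j))\<^sup>2)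
    \<le> (\<Sum>i<m. \<Sum>j<p. (\<Sum>k<n. (A $$ (i, k))\<^sup>2) * (\<Sum>k<n. (B $$ (k, j))\<^sup>2))"
    by (intro sum_mono sum_mult_square_le)
  also have "\<dots> = (\<Sum>i<m. \<Sum>k<n. (A $$ (i, k))\<^sup>2) * (\<Sum>k<n. \<Sum>j<p. (B $$ (k, j))\<^sup>2)"
  proof -
    have "(\<Sum>k<n. \<Sum>j<p. (B $$ (k, j))\<^sup>2) = (\<Sum>j<p. \<Sum>k<n. (B $$ (k, j))\<^sup>2)"
      by (rule sum.swap)
    then show ?thesis by (simp only:) (rule sum_product[symmetric])
  qed
  finally have "sqrt (\<Sum>i<m. \<Sum>j<p. (\<Sum>k<n. A $$ (i, k) * B $$ (k, j))\<^sup>2)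
    \<le> sqrt (\<Sum>i<m. \<Sum>k<n. (A $$ (i, k))\<^sup>2) * sqrt (\<Sum>k<n. \<Sum>j<p. (B $$ (k, j))\<^sup>2)"
    unfolding real_sqrt_mult[symmetric] by (rule real_sqrt_le_mono)
  then show ?thesis
    using assms by (simp add: frob_norm_def scalar_prod_def lessThan_atLeast0)
qed

lemma frob_norm_eq_0:
  assumes "A \<in> carrier_mat m n" "frob_norm A = 0"
  shows "A = 0\<^sub>m m n"
proof (rule eq_matI)
  have "(\<Sum>i<m. \<Sum>j<n. (A $$ (i, j))\<^sup>2) = 0"
    using assms by (simp add: frob_norm_def)
  then have "\<forall>i<m. (\<Sum>j<n. (A $$ (i, j))\<^sup>2) = 0"
    by (subst (asm) sum_nonneg_eq_0_iff) (auto intro: sum_nonneg)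
  then have "\<forall>i<m. \<forall>j<n. (A $$ (i, j))\<^sup>2 = 0"
    by (subst (asm) sum_nonneg_eq_0_iff) auto
  then show "A $$ (i, j) = 0\<^sub>m m n $$ (i, j)" if "i < dim_row (0\<^sub>m m n)" "j < dim_col (0\<^sub>m m n)" for i j
    using that by auto
qed (use assms in auto)

section \<open>Rank, injectivity and left inverses\<close>

text \<open>Full column rank as a trivial kernel, the form that passes directly through products and
  left inverses; \<open>rank_mat_inj\<close> and \<open>mat_inj_if_full_rank\<close> translate to
  and from \<open>vec_space.rank\<close>.\<close>

definition mat_inj :: "'a :: semiring_1 mat \<Rightarrow> bool" where
  "mat_inj A \<longleftrightarrow> (\<forall>v \<in> carrier_vec (dim_col A). A *\<^sub>v v = 0\<^sub>v (dim_row A) \<longrightarrow> v = 0\<^sub>v (dim_col A))"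

text \<open>The column space of the product lies inside that of the left factor, because (A B) x = A
  (B x).\<close>

lemma rank_mult_le:
  fixes A :: "'a :: field mat"
  assumes A: "A \<in> carrier_mat m p" and B: "B \<in> carrier_mat p n"
  shows "vec_space.rank m (A * B) \<le> vec_space.rank m A"
proof -
  interpret vec_space "TYPE('a)" m .
  have AB: "A * B \<in> carrier_mat m n" using A B by simp
  have "y \<in> col_space A" if "y \<in> col_space (A * B)" for y
  proof -
    obtain x where "x \<in> carrier_vec n" "(A * B) *\<^sub>v x = y" "y \<in> carrier_vec m"
      using \<open>y \<in> _\<close> A B unfolding col_space_eq[OF AB] by auto
    then have "A *\<^sub>v (B *\<^sub>v x) = y" "B *\<^sub>v x \<in> carrier_vec p" using A B by auto
    then show ?thesis using A \<open>y \<in> carrier_vec m\<close> unfolding col_space_eq[OF A] by auto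
  qed
  then have sub: "span (set (cols (A * B))) \<subseteq> span (set (cols A))"
    unfolding col_space_def by blast
  have cA: "set (cols A) \<subseteq> carrier_vec m" and cAB: "set (cols (A * B)) \<subseteq> carrier_vec m"
    using A AB cols_dim by blast+
  have sA: "subspace class_ring (span (set (cols A))) V"
    and sAB: "subspace class_ring (span (set (cols (A * B)))) V"
    using span_is_subspace cA cAB by auto
  show ?thesis unfolding rank_def
    using vectorspace.subspace_dim[OF subspace_is_vs[OF sA] nested_subspaces[OF sA sAB sub]
        fin_dim_span_cols[OF A]] fin_dim_span_cols[OF AB] by simp
qed

lemma rank_mat_inj:
  fixes A :: "'a :: field mat"
  assumes A: "A \<in> carrier_mat m n" and inj: "mat_inj A"
  shows "vec_space.rank m A = n"
proof -
  interpret vec_space "TYPE('a)" m .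
  \<comment> \<open>The rank is read off the set of columns, which forgets repetitions. A repeated
    column would put a difference of two unit vectors into the kernel.\<close>
  have dist: "distinct (cols A)"
  proof (rule ccontr)
    assume "\<not> distinct (cols A)"
    then obtain i j where ij: "i < n" "j < n" "i \<noteq> j" "col A i = col A j"
      using A by (auto simp: distinct_conv_nth)
    let ?v = "unit_vec n i - unit_vec n j :: 'a vec"
    have "A *\<^sub>v ?v = 0\<^sub>v m"
    proof -
      have "A *\<^sub>v unit_vec n l = col A l" if "l < n" for l
        using A that by (intro eq_vecI) auto
      then show ?thesis using A ij by (simp add: mult_minus_distrib_mat_vec)
    qed
    then have "?v = 0\<^sub>v n" using inj A unfolding mat_inj_def by simp
    from arg_cong[OF this, of "\<lambda>v. v $ i"] show False using ij by simp
  qed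
  have "lin_indpt (set (cols A))"
    using lin_depE[OF A _ dist] inj A unfolding mat_inj_def by (metis carrier_matD)
  then show ?thesis using lin_indpt_full_rank[OF A dist] by simp
qed

text \<open>The rank is the size of a maximal independent set of columns. If it equals n, the set of
  columns has at least n elements, so no column is repeated and independence of the set is
  independence of the list.\<close>

lemma mat_inj_if_full_rank:
  fixes A :: "'a :: field mat"
  assumes A: "A \<in> carrier_mat m n" and rank: "vec_space.rank m A = n"
  shows "mat_inj A"
proof -
  interpret vec_space "TYPE('a)" m .
  obtain S where S: "maximal S (\<lambda>T. T \<subseteq> set (cols A) \<and> lin_indpt T)"
    using maximal_exists[of "(\<lambda>T. T \<subseteq> set (cols A) \<and> lin_indpt T)" "card (set (cols A))" "{}"]
    by (meson List.finite_set card_mono empty_iff empty_subsetI finite_lin_indpt2 rev_finite_subset)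
  then have "n \<le> card (set (cols A))"
    using rank_card_indpt[OF A S] rank by (metis List.finite_set card_mono maximal_def)
  then have dist: "distinct (cols A)"
    using A card_length[of "cols A"] by (intro card_distinct) simp
  then show ?thesis
    using lin_depI[OF A _ _ _ dist] full_rank_lin_indpt[OF A rank dist] A
    unfolding mat_inj_def by (metis carrier_matD)
qed

lemma mat_inj_invertible:
  fixes A :: "'a :: field mat"
  assumes A: "A \<in> carrier_mat n n" and inj: "mat_inj A"
  shows "\<exists>B \<in> carrier_mat n n. A * B = 1\<^sub>m n \<and> B * A = 1\<^sub>m n"
proof -
  have "det A \<noteq> 0"
    using det_0_iff_vec_prod_zero_field[OF A] inj A unfolding mat_inj_def by (metis carrier_matD)
  from det_non_zero_imp_unit[OF A this] show ?thesis
    unfolding Units_def by (auto simp: ring_mat_simps)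
qed

lemma transpose_mult_self_eq_0:
  fixes A :: "real mat"
  assumes A: "A \<in> carrier_mat m n" and v: "v \<in> carrier_vec n" and 0: "(A\<^sup>T * A) *\<^sub>v v = 0\<^sub>v n"
  shows "A *\<^sub>v v = 0\<^sub>v m"
proof -
  have Av: "A *\<^sub>v v \<in> carrier_vec m" using A v by simp
  have "(A *\<^sub>v v) \<bullet> (A *\<^sub>v v) = ((A\<^sup>T * A) *\<^sub>v v) \<bullet> v"
    using A v transpose_vec_mult_scalar[OF A v Av] by simp
  also have "\<dots> = 0" using v unfolding 0 by simp
  finally show ?thesis using conjugate_square_eq_0_vec[OF Av] by (simp add: conjugate_vec_def)
qed

text \<open>The witness is the pseudo-inverse: the inverse of the Gram matrix times the transpose.
  Any left inverse \<open>B\<close> makes \<open>A * B\<close> a projection onto the column space;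
  symmetry makes that projection orthogonal.\<close>

lemma left_inverse_symmetric_projection:
  fixes A :: "real mat"
  assumes A: "A \<in> carrier_mat m n" and inj: "mat_inj A"
  shows "\<exists>B \<in> carrier_mat n m. B * A = 1\<^sub>m n \<and> (A * B)\<^sup>T = A * B"
proof -
  let ?G = "A\<^sup>T * A"
  have G: "?G \<in> carrier_mat n n" using A by simp
  have "mat_inj ?G"
    using transpose_mult_self_eq_0[OF A] inj A unfolding mat_inj_def
    by (metis G carrier_matD(1) carrier_matD(2))
  then obtain I where I: "I \<in> carrier_mat n n" "?G * I = 1\<^sub>m n" "I * ?G = 1\<^sub>m n"
    using mat_inj_invertible[OF G] by blast
  have "?G\<^sup>T = ?G" using A by (simp add: transpose_mult[of _ n m _ n])
  then have "I\<^sup>T * ?G = (?G * I)\<^sup>T" using transpose_mult[OF G I(1)] by simp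
  then have "I\<^sup>T * ?G = 1\<^sub>m n" using I by simp
  note IG = this
  have "I\<^sup>T = I\<^sup>T * (?G * I)" using I by simp
  also have "\<dots> = I\<^sup>T * ?G * I" using I G by (intro assoc_mult_mat[symmetric]) auto
  also have "\<dots> = I" unfolding IG using I by simp
  finally have IT: "I\<^sup>T = I" .
  show ?thesis
  proof (intro bexI[of _ "I * A\<^sup>T"] conjI)
    show "I * A\<^sup>T * A = 1\<^sub>m n" using A I by simp
    show "(A * (I * A\<^sup>T))\<^sup>T = A * (I * A\<^sup>T)"
      using A I IT by (simp add: transpose_mult[of _ m n _ m] transpose_mult[of _ n n _ m])
  qed (use A I in simp)
qed

section \<open>Block columns and the orthogonal projection\<close>

lemma append_cols_carrier [simp]:
  "A \<in> carrier_mat m a \<Longrightarrow> B \<in> carrier_mat m b \<Longrightarrow> append_cols A B \<in> carrier_mat m (a + b)"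
  using mat_of_cols_carrier(1)[of m "cols A @ cols B"] by (simp add: append_cols_def)

lemma append_cols_dim [simp]:
  "dim_row (append_cols A B) = dim_row A" "dim_col (append_cols A B) = dim_col A + dim_col B"
  by (auto simp: append_cols_def)

lemma append_cols_index:
  assumes "A \<in> carrier_mat m a" "B \<in> carrier_mat m b" "i < m" "j < a + b"
  shows "append_cols A B $$ (i, j) = (if j < a then A $$ (i, j) else B $$ (i, j - a))"
  using assms by (auto simp: append_cols_def mat_of_cols_index nth_append)

text \<open>Lower blocks of height 0 make the multiplication rule of \<open>four_block_mat\<close>
  available for juxtaposed matrices.\<close>

lemma append_cols_four_block:
  assumes "A \<in> carrier_mat m a" "B \<in> carrier_mat m b"
  shows "append_cols A B = four_block_mat A B (0\<^sub>m 0 a) (0\<^sub>m 0 b)"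
  using append_cols_carrier[OF assms]
  by (intro eq_matI) (use assms in \<open>auto simp: append_cols_index[OF assms]\<close>)

lemma append_cols_mult_four_block:
  assumes A: "A \<in> carrier_mat m a" and B: "B \<in> carrier_mat m b"
    and "E \<in> carrier_mat a c" "F \<in> carrier_mat a d" "G \<in> carrier_mat b c" "H \<in> carrier_mat b d"
  shows "append_cols A B * four_block_mat E F G H = append_cols (A * E + B * G) (A * F + B * H)"
proof -
  have "append_cols A B * four_block_mat E F G H
    = four_block_mat (A * E + B * G) (A * F + B * H)
        (0\<^sub>m 0 a * E + 0\<^sub>m 0 b * G) (0\<^sub>m 0 a * F + 0\<^sub>m 0 b * H)"
    unfolding append_cols_four_block[OF A B] using assms
    by (intro mult_four_block_mat[of _ m a _ b _ 0]) auto
  also have "\<dots> = append_cols (A * E + B * G) (A * F + B * H)"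
    using assms by (subst append_cols_four_block[of _ m c _ d]) auto
  finally show ?thesis .
qed

lemma mult_append_cols:
  assumes S: "S \<in> carrier_mat p m" and A: "A \<in> carrier_mat m a" and B: "B \<in> carrier_mat m b"
  shows "S * append_cols A B = append_cols (S * A) (S * B)"
proof -
  have "four_block_mat S (0\<^sub>m p 0) (0\<^sub>m 0 m) (0\<^sub>m 0 0) = S"
    using S by (intro eq_matI) auto
  then have "S * append_cols A B
    = four_block_mat S (0\<^sub>m p 0) (0\<^sub>m 0 m) (0\<^sub>m 0 0) * four_block_mat A B (0\<^sub>m 0 a) (0\<^sub>m 0 b)"
    using append_cols_four_block[OF A B] by simp
  also have "\<dots> = four_block_mat (S * A + 0\<^sub>m p 0 * 0\<^sub>m 0 a) (S * B + 0\<^sub>m p 0 * 0\<^sub>m 0 b)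
     (0\<^sub>m 0 m * A + 0\<^sub>m 0 0 * 0\<^sub>m 0 a) (0\<^sub>m 0 m * B + 0\<^sub>m 0 0 * 0\<^sub>m 0 b)"
    using assms by (intro mult_four_block_mat[of _ p m _ 0 _ 0]) auto
  also have "\<dots> = append_cols (S * A) (S * B)"
    using assms by (subst append_cols_four_block[of _ p a _ b]) auto
  finally show ?thesis .
qed

lemma append_cols_diff:
  assumes "A \<in> carrier_mat m a" "B \<in> carrier_mat m b" "C \<in> carrier_mat m a" "D \<in> carrier_mat m b"
  shows "append_cols A B - append_cols C D = append_cols (A - C) (B - D)"
proof -
  have "append_cols A B \<in> carrier_mat m (a + b)" "append_cols C D \<in> carrier_mat m (a + b)"
    "A - C \<in> carrier_mat m a" "B - D \<in> carrier_mat m b"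
    using assms by (auto intro: minus_carrier_mat)
  then show ?thesis
    using assms by (intro eq_matI) (auto simp: append_cols_index[of _ m a _ b])
qed

lemma append_cols_hadamard:
  assumes "A \<in> carrier_mat m a" "B \<in> carrier_mat m b" "C \<in> carrier_mat m a" "D \<in> carrier_mat m b"
  shows "append_cols A B \<odot>\<^sub>H append_cols C D = append_cols (A \<odot>\<^sub>H C) (B \<odot>\<^sub>H D)"
proof -
  have car: "A \<odot>\<^sub>H C \<in> carrier_mat m a" "B \<odot>\<^sub>H D \<in> carrier_mat m b"
    using assms by (auto simp: hadamard_def)
  have "append_cols A B \<in> carrier_mat m (a + b)"
    "append_cols (A \<odot>\<^sub>H C) (B \<odot>\<^sub>H D) \<in> carrier_mat m (a + b)"
    using assms car by auto
  then show ?thesis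
    using assms car
    by (intro eq_matI) (auto simp: append_cols_index[of _ m a _ b] hadamard_def)
qed

lemma fip_append_cols:
  assumes "A \<in> carrier_mat m a" "B \<in> carrier_mat m b"
  shows "fip (append_cols A B) (append_cols A B) = fip A A + fip B B"
proof -
  have "append_cols A B \<in> carrier_mat m (a + b)" using assms by simp
  then have "fip (append_cols A B) (append_cols A B)
    = (\<Sum>i<m. \<Sum>j<a + b. (if j < a then A $$ (i, j) else B $$ (i, j - a))\<^sup>2)"
    using assms unfolding fip_def
    by (intro sum.cong) (auto simp: append_cols_index power2_eq_square)
  also have "\<dots> = (\<Sum>i<m. (\<Sum>j<a. (A $$ (i, j))\<^sup>2) + (\<Sum>j<b. (B $$ (i, j))\<^sup>2))"
  proof (intro sum.cong refl)
    fix i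
    have "(\<Sum>j<a + b. (if j < a then A $$ (i, j) else B $$ (i, j - a))\<^sup>2)
      = (\<Sum>j<a. (if j < a then A $$ (i, j) else B $$ (i, j - a))\<^sup>2)
        + (\<Sum>j<b. (if a + j < a then A $$ (i, a + j) else B $$ (i, a + j - a))\<^sup>2)"
      by (induction b) auto
    then show "(\<Sum>j<a + b. (if j < a then A $$ (i, j) else B $$ (i, j - a))\<^sup>2)
      = (\<Sum>j<a. (A $$ (i, j))\<^sup>2) + (\<Sum>j<b. (B $$ (i, j))\<^sup>2)"
      by simp
  qed
  finally show ?thesis
    using assms by (simp add: fip_def power2_eq_square sum.distrib)
qed

lemma mat_inj_if_left_inverse:
  fixes M :: "'a :: comm_ring_1 mat"
  assumes M: "M \<in> carrier_mat m p" and L: "L \<in> carrier_mat p m" and LM: "L * M = 1\<^sub>m p"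
  shows "mat_inj M"
proof -
  have "v = 0\<^sub>v p" if v: "v \<in> carrier_vec p" and 0: "M *\<^sub>v v = 0\<^sub>v m" for v
  proof -
    have "v = (L * M) *\<^sub>v v" using v LM by simp
    also have "\<dots> = L *\<^sub>v (M *\<^sub>v v)" using v L M by simp
    finally show ?thesis using L unfolding 0 by auto
  qed
  then show ?thesis using M unfolding mat_inj_def by auto
qed

lemma scalar_prod_self_eq_0:
  fixes w :: "real vec"
  assumes "w \<in> carrier_vec n" "w \<bullet> w = 0"
  shows "w = 0\<^sub>v n"
  using conjugate_square_eq_0_vec[OF assms(1)] assms(2) by (simp add: conjugate_vec_def)

text \<open>With P = A B, symmetry and P A = A give \<open>A\<^sup>T\<close> P =
  \<open>A\<^sup>T\<close>, so v - P v is orthogonal to every column of A. What is subtracted, P v =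
  A (B v), lies in the column space and is therefore orthogonal to the whole complement.\<close>

lemma orth_proj_orthogonal_complement:
  fixes A :: "real mat"
  assumes A: "A \<in> carrier_mat m k" and B: "B \<in> carrier_mat k m" and BA: "B * A = 1\<^sub>m k"
    and sym: "(A * B)\<^sup>T = A * B" and v: "v \<in> carrier_vec m"
  shows "orth_proj (vec_module.orthogonal_complement m (vec_space.col_space m A)) v
    = v - (A * B) *\<^sub>v v"
proof -
  interpret vec_space "TYPE(real)" m .
  let ?S = "orthogonal_complement (col_space A)" and ?p = "v - (A * B) *\<^sub>v v"
  have S: "x \<in> ?S \<longleftrightarrow> x \<in> carrier_vec m \<and> (\<forall>y \<in> carrier_vec k. x \<bullet> (A *\<^sub>v y) = 0)" for x
  proof -
    have "y \<in> col_space A \<longleftrightarrow> (\<exists>x \<in> carrier_vec k. y = A *\<^sub>v x)" for y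
      using A unfolding col_space_eq[OF A] by auto
    then show ?thesis unfolding orthogonal_complement_def mem_Collect_eq by metis
  qed
  have "A\<^sup>T * (A * B) = (A * B * A)\<^sup>T"
    using A B transpose_mult[of "A * B" m m A k] sym by (metis mult_carrier_mat)
  also have "A * B * A = A" using A B BA by simp
  finally have AT: "A\<^sup>T * (A * B) = A\<^sup>T" .
  have "A\<^sup>T *\<^sub>v ?p = A\<^sup>T *\<^sub>v v - A\<^sup>T *\<^sub>v ((A * B) *\<^sub>v v)"
    using A B v by (intro mult_minus_distrib_mat_vec[of _ k m]) auto
  also have "A\<^sup>T *\<^sub>v ((A * B) *\<^sub>v v) = (A\<^sup>T * (A * B)) *\<^sub>v v"
    using A B v by (intro assoc_mult_mat_vec[symmetric, of _ k m _ m]) auto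
  finally have ATp: "A\<^sup>T *\<^sub>v ?p = 0\<^sub>v k" using A v unfolding AT by simp
  have p: "?p \<in> carrier_vec m" using A B v by auto
  show ?thesis unfolding orth_proj_def
  proof (rule the_equality, intro conjI ballI)
    show pS: "?p \<in> ?S"
      using p ATp A transpose_vec_mult_scalar[OF A _ p] unfolding S by auto
    have vp: "(v - ?p) = A *\<^sub>v (B *\<^sub>v v)"
    proof -
      have "v - ?p = (A * B) *\<^sub>v v" using A B v by (intro eq_vecI) auto
      then show ?thesis using A B v by simp
    qed
    show orth: "(v - ?p) \<bullet> u = 0" if "u \<in> ?S" for u
      using that A B v unfolding S vp by (subst comm_scalar_prod[of _ m]) auto
    \<comment> \<open>Uniqueness for the definite description: the difference of two candidates lies
      in the complement and is orthogonal to it, hence to itself.\<close>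
    fix p' assume p': "p' \<in> ?S \<and> (\<forall>u\<in>?S. (v - p') \<bullet> u = 0)"
    then have p'c: "p' \<in> carrier_vec m" unfolding S by simp
    let ?w = "p' - ?p"
    have w: "?w \<in> ?S"
      using p' pS A unfolding S by (auto simp: minus_scalar_prod_distrib[of _ m])
    have "x - y = (v - y) - (v - x)" if "x \<in> carrier_vec m" "y \<in> carrier_vec m" for x y
      using that v by (intro eq_vecI) auto
    from this[OF p'c p] have "?w \<bullet> ?w = ((v - ?p) - (v - p')) \<bullet> ?w" by simp
    also have "\<dots> = (v - ?p) \<bullet> ?w - (v - p') \<bullet> ?w"
      using p p'c v by (intro minus_scalar_prod_distrib[of _ m]) auto
    also have "\<dots> = 0" using w p' orth by simp
    finally have "?w = 0\<^sub>v m" using p p'c by (intro scalar_prod_self_eq_0) auto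
    moreover have "x = y" if "x - y = 0\<^sub>v m" "x \<in> carrier_vec m" "y \<in> carrier_vec m" for x y :: "real vec"
    proof (rule eq_vecI)
      fix i assume i: "i < dim_vec y"
      then have "x $ i - y $ i = (x - y) $ i" by simp
      also have "\<dots> = 0" unfolding that(1) using i that(3) by simp
      finally show "x $ i = y $ i" by simp
    qed (use that in simp)
    ultimately show "p' = ?p" using p p'c by blast
  qed
qed

lemma proj_perp_eq:
  fixes A :: "real mat"
  assumes A: "A \<in> carrier_mat m k" and B: "B \<in> carrier_mat k m" and BA: "B * A = 1\<^sub>m k"
    and sym: "(A * B)\<^sup>T = A * B" and X: "X \<in> carrier_mat m l"
  shows "proj_perp A X = X - A * B * X"
proof -
  define P where "P = A * B"
  have P: "P \<in> carrier_mat m m" using A B by (simp add: P_def)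
  show ?thesis
  proof (rule eq_matI)
    fix i j assume "i < dim_row (X - A * B * X)" "j < dim_col (X - A * B * X)"
    then have i: "i < m" and j: "j < l" using A X by auto
    have "proj_perp A X $$ (i, j) = (col X j - (A * B) *\<^sub>v col X j) $ i"
      using i j A X orth_proj_orthogonal_complement[OF A B BA sym, of "col X j"]
      by (simp add: proj_perp_def mat_of_cols_index)
    also have "\<dots> = (X - P * X) $$ (i, j)"
      using i j X P unfolding P_def[symmetric] by simp
    finally show "proj_perp A X $$ (i, j) = (X - A * B * X) $$ (i, j)"
      unfolding P_def .
  qed (use A B X in \<open>auto simp: proj_perp_def\<close>)
qed

section \<open>Singular values and quadratic growth of low-rank approximation\<close>

lemma gram_mat_mult:
  fixes A :: "'a :: comm_semiring_1 mat"
  assumes A: "A \<in> carrier_mat m n" and V: "V \<in> carrier_mat n p"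
  shows "(A * V)\<^sup>T * (A * V) = V\<^sup>T * (A\<^sup>T * A * V)"
proof -
  have "(A * V)\<^sup>T * (A * V) = V\<^sup>T * A\<^sup>T * (A * V)" by (simp add: transpose_mult[OF A V])
  also have "\<dots> = V\<^sup>T * (A\<^sup>T * (A * V))" using A V by (intro assoc_mult_mat[of _ p n _ m]) auto
  also have "A\<^sup>T * (A * V) = A\<^sup>T * A * V"
    using A V by (intro assoc_mult_mat[symmetric, of _ n m _ n]) auto
  finally show ?thesis .
qed

text \<open>The right half of a singular value decomposition: the columns of \<open>B * U\<close>
  are pairwise orthogonal, and their squared lengths are the squared singular values in decreasing
  order, zeros included. Being squared lengths, the eigenvalues are nonnegative.\<close>

lemma gram_spectral_decomposition:
  fixes B :: "real mat"
  assumes B: "B \<in> carrier_mat m l"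
  obtains es U where "length es = l" "sorted_wrt (\<ge>) es" "\<forall>e\<in>set es. 0 \<le> e"
    "char_poly (B\<^sup>T * B) = (\<Prod>e\<leftarrow>es. [:- e, 1:])"
    "U \<in> carrier_mat l l" "U\<^sup>T * U = 1\<^sub>m l" "(B * U)\<^sup>T * (B * U) = mat_diag l (\<lambda>i. es ! i)"
proof -
  let ?G = "B\<^sup>T * B"
  have G: "?G \<in> carrier_mat l l" "?G\<^sup>T = ?G"
    using B by (auto simp: transpose_mult[of _ l m _ l])
  obtain es0 where es0: "char_poly ?G = (\<Prod>e\<leftarrow>es0. [:- e, 1:])"
    using char_poly_symmetric_splits[OF G] by blast
  define es where "es = rev (sort es0)"
  have "(\<Prod>e\<leftarrow>es0. [:- e, 1:]) = (\<Prod>e\<leftarrow>es. [:- e, 1:])"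
    unfolding prod_mset_prod_list[symmetric] mset_map by (simp add: es_def)
  then have cp: "char_poly ?G = (\<Prod>e\<leftarrow>es. [:- e, 1:])" using es0 by simp
  obtain U where U: "U \<in> carrier_mat l l" "U\<^sup>T * U = 1\<^sub>m l" "U\<^sup>T * ?G * U = mat_diag l (\<lambda>i. es ! i)"
    using spectral_theorem_symmetric[OF G cp] by blast
  have len: "length es = l"
    using degree_monic_char_poly[OF G(1)] degree_linear_factors[of uminus es] unfolding cp by simp
  have "sorted_wrt (\<ge>) es" unfolding es_def sorted_wrt_rev by simp
  moreover have BU: "(B * U)\<^sup>T * (B * U) = mat_diag l (\<lambda>i. es ! i)"
  proof -
    have "U\<^sup>T * (?G * U) = U\<^sup>T * ?G * U"
      using U G by (intro assoc_mult_mat[symmetric, of _ l l _ l]) auto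
    then show ?thesis unfolding gram_mat_mult[OF B U(1)] U(3) .
  qed
  moreover have "0 \<le> e" if "e \<in> set es" for e
  proof -
    obtain i where i: "i < l" "e = es ! i" using \<open>e \<in> set es\<close> unfolding in_set_conv_nth len by blast
    have "e = ((B * U)\<^sup>T * (B * U)) $$ (i, i)" unfolding BU using i by (simp add: mat_diag_def)
    also have "\<dots> = (\<Sum>a<m. ((B * U) $$ (a, i))\<^sup>2)"
      using i B U by (simp add: scalar_prod_def lessThan_atLeast0 power2_eq_square)
    finally show ?thesis by (simp add: sum_nonneg)
  qed
  ultimately show thesis using that len cp U by blast
qed

text \<open>\<open>sing_val\<close> is computed from a list without zeros and returns 0 beyond its
  end. In a decreasing nonnegative list the zeros form a suffix, so removing them and padding by 0
  again changes no value; the filter becomes a \<open>takeWhile\<close>.\<close>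

lemma sing_val_eq:
  fixes B :: "real mat"
  assumes cp: "char_poly (B\<^sup>T * B) = (\<Prod>e\<leftarrow>es. [:- e, 1:])"
    and sorted: "sorted_wrt (\<ge>) es" and nonneg: "\<forall>e\<in>set es. 0 \<le> e"
  shows "sing_val B j = (if j = 0 then \<infinity> else if j \<le> length es then ereal (sqrt (es ! (j - 1))) else 0)"
proof -
  let ?fs = "filter (\<lambda>x. 0 < x) es"
  have "proots (\<Prod>e\<leftarrow>es. [:- e, 1:]) = mset es"
    by (induction es) (simp_all add: proots_mult prod_list_zero_iff image_iff del: mult_pCons_left)
  then have "proots (char_poly (B\<^sup>T * B)) = mset es" unfolding cp .
  moreover have "filter_mset (\<lambda>x. x \<noteq> 0) (mset es) = mset ?fs"
    unfolding mset_filter by (intro filter_mset_cong) (use nonneg in force)+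
  ultimately have "nonzero_singular_values B = rev (sort (map sqrt ?fs))"
    unfolding nonzero_singular_values_def
    by (simp only: mset_map[symmetric] sorted_list_of_multiset_mset)
  also have "sort (map sqrt ?fs) = rev (map sqrt ?fs)"
    using sorted_wrt_filter[OF sorted]
    by (intro properties_for_sort) (auto simp: sorted_wrt_rev sorted_wrt_map)
  also have "?fs = takeWhile (\<lambda>x. 0 < x) es"
    using filter_equals_takeWhile_sorted_rev[of id es 0] sorted by (simp add: sorted_wrt_rev)
  finally have nsv: "nonzero_singular_values B = map sqrt (takeWhile (\<lambda>x. 0 < x) es)" by simp
  let ?p = "length (takeWhile (\<lambda>x. 0 < x) es)"
  have zero: "es ! i = 0" if "?p \<le> i" "i < length es" for i
  proof -
    have "\<not> 0 < es ! ?p" using that by (intro nth_length_takeWhile) simp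
    moreover have "es ! i \<le> es ! ?p"
      using sorted that by (cases "i = ?p") (auto simp: sorted_wrt_iff_nth_less)
    ultimately show ?thesis using nonneg that by (metis nth_mem order.antisym linorder_not_less order.trans)
  qed
  have "?p \<le> length es" by (rule length_takeWhile_le)
  then show ?thesis
    unfolding sing_val_def nsv using zero[of "j - 1"] by (auto simp: takeWhile_nth)
qed

text \<open>The numbers in \<open>es\<close> are squared singular values, so stretching the tail by
  t multiplies its entries by the square of t. The threshold \<theta> certifies that the stretched
  tail still does not exceed the head.\<close>

lemma gap_threshold:
  fixes es :: "real list"
  assumes sorted: "sorted_wrt (\<ge>) es" and nonneg: "\<forall>e\<in>set es. 0 \<le> e" and q: "q \<le> length es"
    and gap: "0 < q \<Longrightarrow> q < length es \<Longrightarrow> es ! q < es ! (q - 1)"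
  obtains t \<theta> where "1 < t" "\<And>j. j < q \<Longrightarrow> \<theta> \<le> es ! j"
    "\<And>j. q \<le> j \<Longrightarrow> j < length es \<Longrightarrow> t\<^sup>2 * es ! j \<le> \<theta>"
proof (cases "q = length es")
  case True
  show ?thesis by (rule that[of 2 0]) (use True nonneg in auto)
next
  case False
  then have ql: "q < length es" using q by simp
  have mono: "es ! j \<le> es ! i" if "i \<le> j" "j < length es" for i j
    using sorted that by (cases "i = j") (auto simp: sorted_wrt_iff_nth_less)
  have d: "0 \<le> es ! q" using nonneg ql by simp
  show ?thesis
  proof (cases "0 < q \<and> 0 < es ! q")
    case True
    \<comment> \<open>The ratio of the two singular values at the gap, which is the largest
      stretching allowed. In the other cases the head is empty, the tail is empty or the tail is
      zero, and the value 2 serves.\<close>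
    define t where "t = sqrt (es ! (q - 1) / es ! q)"
    have t1: "1 < es ! (q - 1) / es ! q" using True gap ql by simp
    then have tq: "t\<^sup>2 * es ! q = es ! (q - 1)" using True by (simp add: t_def)
    show ?thesis
    proof (rule that[of t "es ! (q - 1)"])
      show "1 < t" using t1 by (simp add: t_def)
      show "es ! (q - 1) \<le> es ! j" if "j < q" for j using mono[of j "q - 1"] that ql by auto
      show "t\<^sup>2 * es ! j \<le> es ! (q - 1)" if "q \<le> j" "j < length es" for j
        unfolding tq[symmetric] using mono[OF that] by (intro mult_left_mono) auto
    qed
  next
    case False
    show ?thesis
    proof (rule that[of 2 "4 * es ! q"])
      show "4 * es ! q \<le> es ! j" if "j < q" for j
        using False that d nonneg ql by auto
      show "2\<^sup>2 * es ! j \<le> 4 * es ! q" if "q \<le> j" "j < length es" for j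
        using mono[OF that] by simp
    qed simp
  qed
qed

text \<open>Weights in [0, 1] of total l - q give the smallest sum when concentrated on the l - q
  smallest values. Termwise, (d_j - \<theta>) (w_j - [q \<le> j]) is nonnegative, and the
  differences w_j - [q \<le> j] sum to 0, which removes \<theta>.\<close>

lemma weighted_sum_ge_tail:
  fixes d w :: "nat \<Rightarrow> real"
  assumes w: "\<And>j. j < l \<Longrightarrow> 0 \<le> w j \<and> w j \<le> 1" and sum: "(\<Sum>j<l. w j) = real (l - q)"
    and low: "\<And>j. j < q \<Longrightarrow> \<theta> \<le> d j" and high: "\<And>j. q \<le> j \<Longrightarrow> j < l \<Longrightarrow> d j \<le> \<theta>"
  shows "(\<Sum>j=q..<l. d j) \<le> (\<Sum>j<l. d j * w j)"
proof -
  have split: "(\<Sum>j=q..<l. f j) = (\<Sum>j<l. if j < q then 0 else f j)" for f :: "nat \<Rightarrow> real"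
    by (rule sum.mono_neutral_cong_left) auto
  have "(\<Sum>j<l. \<theta> * (w j - (if j < q then 0 else 1)))
    \<le> (\<Sum>j<l. d j * w j - (if j < q then 0 else d j))"
  proof (rule sum_mono)
    fix j assume "j \<in> {..<l}"
    then have j: "j < l" by simp
    show "\<theta> * (w j - (if j < q then 0 else 1)) \<le> d j * w j - (if j < q then 0 else d j)"
    proof (cases "j < q")
      case True
      then show ?thesis using mult_right_mono[OF low, of j "w j"] w[OF j] by simp
    next
      case False
      then have "d j * (1 - w j) \<le> \<theta> * (1 - w j)" using high w j by (intro mult_right_mono) auto
      then show ?thesis using False by (simp add: algebra_simps)
    qed
  qed
  moreover have "(\<Sum>j<l. \<theta> * (w j - (if j < q then 0 else 1))) = 0"
    using split[of "\<lambda>_. 1"] by (simp add: sum sum_subtractf flip: sum_distrib_left)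
  ultimately show ?thesis unfolding split[of d] by (simp add: sum_subtractf)
qed

text \<open>The lower bound of Eckart and Young, with the rank bound on \<open>Y\<close> expressed
  by an orthogonal \<open>V\<close> for which \<open>Y * V\<close> vanishes from column q on. In
  those columns \<open>(A - Y) * V\<close> agrees with \<open>A * V\<close>; discarding the other
  columns only lowers the norm.\<close>

lemma low_rank_error_ge:
  fixes A Y V :: "real mat"
  assumes A: "A \<in> carrier_mat m l" and AA: "A\<^sup>T * A = mat_diag l d"
    and Y: "Y \<in> carrier_mat m l" and V: "V \<in> carrier_mat l l" and VV: "V\<^sup>T * V = 1\<^sub>m l"
    and YV: "\<And>i j. i < m \<Longrightarrow> q \<le> j \<Longrightarrow> j < l \<Longrightarrow> (Y * V) $$ (i, j) = 0"
    and low: "\<And>j. j < q \<Longrightarrow> \<theta> \<le> d j" and high: "\<And>j. q \<le> j \<Longrightarrow> j < l \<Longrightarrow> d j \<le> \<theta>"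
  shows "(\<Sum>j=q..<l. d j) \<le> fip (A - Y) (A - Y)"
proof -
  have VV': "V * V\<^sup>T = 1\<^sub>m l" using mat_mult_left_right_inverse[OF _ V VV] V by simp
  \<comment> \<open>The squared length of the part of row j of \<open>V\<close> lying in the columns
    from q on. Unit rows put it in [0, 1], and unit columns make the total l - q.\<close>
  define w where "w j = (\<Sum>i=q..<l. (V $$ (j, i))\<^sup>2)" for j
  have rows: "(\<Sum>i<l. (V $$ (j, i))\<^sup>2) = 1" if "j < l" for j
  proof -
    have "(V * V\<^sup>T) $$ (j, j) = (\<Sum>i<l. (V $$ (j, i))\<^sup>2)"
      using V that by (simp add: scalar_prod_def lessThan_atLeast0 power2_eq_square)
    then show ?thesis using that unfolding VV' by simp
  qed
  have cols: "(\<Sum>j<l. (V $$ (j, i))\<^sup>2) = 1" if "i < l" for i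
  proof -
    have "(V\<^sup>T * V) $$ (i, i) = (\<Sum>j<l. (V $$ (j, i))\<^sup>2)"
      using V that by (simp add: scalar_prod_def lessThan_atLeast0 power2_eq_square)
    then show ?thesis using that unfolding VV by simp
  qed
  have w01: "0 \<le> w j \<and> w j \<le> 1" if "j < l" for j
  proof -
    have "w j \<le> (\<Sum>i<l. (V $$ (j, i))\<^sup>2)" unfolding w_def by (intro sum_mono2) auto
    then show ?thesis using rows[OF that] by (simp add: w_def sum_nonneg)
  qed
  have "(\<Sum>j<l. w j) = (\<Sum>i=q..<l. \<Sum>j<l. (V $$ (j, i))\<^sup>2)"
    unfolding w_def by (rule sum.swap)
  then have wsum: "(\<Sum>j<l. w j) = real (l - q)" by (simp add: cols)
  have entry: "((A * V)\<^sup>T * (A * V)) $$ (i, i) = (\<Sum>j<l. d j * (V $$ (j, i))\<^sup>2)" if "i < l" for i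
  proof -
    have "(A * V)\<^sup>T * (A * V) = V\<^sup>T * (A\<^sup>T * A * V)"
      by (rule gram_mat_mult[OF A V])
    also have "A\<^sup>T * A * V = mat l l (\<lambda>(j, i). d j * V $$ (j, i))"
      unfolding AA by (rule mat_diag_mult_left[OF V])
    finally show ?thesis
      using that V by (simp add: scalar_prod_def lessThan_atLeast0 power2_eq_square mult_ac)
  qed
  have "(\<Sum>j=q..<l. d j) \<le> (\<Sum>j<l. d j * w j)"
    using weighted_sum_ge_tail[OF w01 wsum low high] by simp
  also have "\<dots> = (\<Sum>i=q..<l. \<Sum>j<l. d j * (V $$ (j, i))\<^sup>2)"
    unfolding w_def sum_distrib_left by (rule sum.swap)
  also have "\<dots> = (\<Sum>i=q..<l. (((A - Y) * V)\<^sup>T * ((A - Y) * V)) $$ (i, i))"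
  proof (intro sum.cong refl)
    fix i assume i: "i \<in> {q..<l}"
    define N where "N = (A - Y) * V"
    define N' where "N' = A * V"
    define K where "K = Y * V"
    have car: "N \<in> carrier_mat m l" "N' \<in> carrier_mat m l" "K \<in> carrier_mat m l"
      using A Y V by (auto simp: N_def N'_def K_def)
    have "N = N' - K" using A Y V by (simp add: N_def N'_def K_def minus_mult_distrib_mat)
    then have "N $$ (a, i) = N' $$ (a, i)" if "a < m" for a
      using i that car YV[OF that, folded K_def] by simp
    then have "col N i = col N' i"
      using i car by (intro eq_vecI) auto
    then have "(N'\<^sup>T * N') $$ (i, i) = (N\<^sup>T * N) $$ (i, i)"
      using i car by simp
    then show "(\<Sum>j<l. d j * (V $$ (j, i))\<^sup>2) = (((A - Y) * V)\<^sup>T * ((A - Y) * V)) $$ (i, i)"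
      using entry[of i] i by (simp add: N_def N'_def)
  qed
  also have "\<dots> \<le> (\<Sum>i<l. (((A - Y) * V)\<^sup>T * ((A - Y) * V)) $$ (i, i))"
    using A Y V
    by (intro sum_mono2) (auto simp: scalar_prod_def simp del: col_mult2 intro!: sum_nonneg)
  also have "\<dots> = fip ((A - Y) * V) ((A - Y) * V)"
    using A Y V by (intro fip_columns[symmetric]) auto
  also have "\<dots> = fip (A - Y) (A - Y)"
    using A Y by (intro fip_mult_orthogonal[OF _ V VV]) auto
  finally show ?thesis .
qed

lemma fip_expand_add:
  assumes "A \<in> carrier_mat m n" "B \<in> carrier_mat m n"
  shows "fip (A + B) (A + B) = fip A A + 2 * fip A B + fip B B"
  using assms fip_commute[OF assms]
  by (simp add: fip_add_left[of _ m n] fip_add_right[of _ m n])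

text \<open>Since the columns of \<open>B\<close> are orthogonal here, truncating the singular
  values means keeping the first q columns, and stretching the residual means scaling the remaining
  ones by t. The matrix \<open>A\<close> in the proof is the stretched one, whose distance to
  \<open>H\<close> is t times that of \<open>B\<close>.\<close>

lemma diagonal_truncation_growth:
  fixes B Y V :: "real mat"
  assumes B: "B \<in> carrier_mat m l" and BB: "B\<^sup>T * B = mat_diag l d"
    and Y: "Y \<in> carrier_mat m l" and V: "V \<in> carrier_mat l l" and VV: "V\<^sup>T * V = 1\<^sub>m l"
    and YV: "\<And>i j. i < m \<Longrightarrow> q \<le> j \<Longrightarrow> j < l \<Longrightarrow> (Y * V) $$ (i, j) = 0"
    and t: "1 < t" and low: "\<And>j. j < q \<Longrightarrow> \<theta> \<le> d j"
    and high: "\<And>j. q \<le> j \<Longrightarrow> j < l \<Longrightarrow> t\<^sup>2 * d j \<le> \<theta>"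
    and H: "H = B * mat_diag l (\<lambda>j. if j < q then 1 else 0)"
  shows "fip (B - H) (B - H) + (1 - 1 / t) * fip (Y - H) (Y - H) \<le> fip (B - Y) (B - Y)"
proof -
  define M where "M = B - H"
  define A where "A = B * mat_diag l (\<lambda>j. if j < q then 1 else t)"
  have Hi: "H = mat m l (\<lambda>(i, j). B $$ (i, j) * (if j < q then 1 else 0))"
    unfolding H by (rule mat_diag_mult_right[OF B])
  have Ai: "A = mat m l (\<lambda>(i, j). B $$ (i, j) * (if j < q then 1 else t))"
    unfolding A_def by (rule mat_diag_mult_right[OF B])
  have Hc: "H \<in> carrier_mat m l" and Ac: "A \<in> carrier_mat m l" unfolding Hi Ai by auto
  have Mc: "M \<in> carrier_mat m l" unfolding M_def by (rule minus_carrier_mat[OF Hc])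
  have BBij: "(\<Sum>a<m. B $$ (a, i) * B $$ (a, j)) = (if i = j then d i else 0)"
    if "i < l" "j < l" for i j
  proof -
    have "(\<Sum>a<m. B $$ (a, i) * B $$ (a, j)) = (B\<^sup>T * B) $$ (i, j)"
      using B that by (simp add: scalar_prod_def lessThan_atLeast0)
    also have "\<dots> = (if i = j then d i else 0)" unfolding BB using that by (simp add: mat_diag_def)
    finally show ?thesis .
  qed
  have AA: "A\<^sup>T * A = mat_diag l (\<lambda>j. if j < q then d j else t\<^sup>2 * d j)"
  proof (rule eq_matI)
    fix i j assume "i < dim_row (mat_diag l (\<lambda>j. if j < q then d j else t\<^sup>2 * d j))"
      "j < dim_col (mat_diag l (\<lambda>j. if j < q then d j else t\<^sup>2 * d j))"
    then have i: "i < l" and j: "j < l" by (auto simp: mat_diag_def)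
    let ?c = "\<lambda>j. if j < q then 1 else t"
    have "(A\<^sup>T * A) $$ (i, j) = (\<Sum>a<m. (?c i * ?c j) * (B $$ (a, i) * B $$ (a, j)))"
      using i j Ac by (simp add: scalar_prod_def lessThan_atLeast0 Ai mult_ac)
    also have "\<dots> = (?c i * ?c j) * (if i = j then d i else 0)"
      by (simp only: BBij[OF i j] flip: sum_distrib_left)
    finally show "(A\<^sup>T * A) $$ (i, j) = mat_diag l (\<lambda>j. if j < q then d j else t\<^sup>2 * d j) $$ (i, j)"
      using i j by (auto simp: mat_diag_def power2_eq_square)
  qed (use Ac in \<open>auto simp: mat_diag_def\<close>)
  have MM: "fip M M = (\<Sum>j=q..<l. d j)"
  proof -
    have "fip M M = (\<Sum>j<l. \<Sum>a<m. M $$ (a, j) * M $$ (a, j))"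
      using Mc unfolding fip_def by simp (rule sum.swap)
    also have "\<dots> = (\<Sum>j<l. if j < q then 0 else d j)"
    proof (intro sum.cong refl)
      fix j assume "j \<in> {..<l}"
      then show "(\<Sum>a<m. M $$ (a, j) * M $$ (a, j)) = (if j < q then 0 else d j)"
        using BBij[of j j] B Hc by (simp add: M_def Hi)
    qed
    also have "\<dots> = (\<Sum>j=q..<l. d j)"
      by (rule sum.mono_neutral_cong_right) auto
    finally show ?thesis .
  qed
  have "(\<Sum>j=q..<l. if j < q then d j else t\<^sup>2 * d j) \<le> fip (A - Y) (A - Y)"
    by (rule low_rank_error_ge[OF Ac AA Y V VV YV, where \<theta> = \<theta>]) (use low high in auto)
  moreover have "(\<Sum>j=q..<l. if j < q then d j else t\<^sup>2 * d j) = t\<^sup>2 * fip M M"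
    unfolding MM sum_distrib_left by (intro sum.cong) auto
  moreover have "A - Y = t \<cdot>\<^sub>m M + (H - Y)"
    using B Hc Ac Y by (intro eq_matI) (auto simp: Ai Hi M_def algebra_simps)
  moreover have "fip (t \<cdot>\<^sub>m M + (H - Y)) (t \<cdot>\<^sub>m M + (H - Y))
      = t\<^sup>2 * fip M M + 2 * t * fip M (H - Y) + fip (H - Y) (H - Y)"
    using Mc Hc Y
    by (subst fip_expand_add[of _ m l])
      (auto simp: fip_smult_left[of _ m l] fip_smult_right[of _ m l] power2_eq_square)
  \<comment> \<open>The square of t times \<open>fip M M\<close> is both the lower bound and the
    leading term of the expansion, so it cancels. Dividing the rest by t leaves the factor 1 / t in
    the bound on the mixed term.\<close>
  ultimately have "0 \<le> 2 * t * fip M (H - Y) + fip (H - Y) (H - Y)" by simp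
  then have cross: "- (1 / t) * fip (H - Y) (H - Y) \<le> 2 * fip M (H - Y)"
    using t by (simp add: field_simps)
  have "B - Y = M + (H - Y)"
    using B Hc Y by (intro eq_matI) (auto simp: M_def)
  then have "fip (B - Y) (B - Y) = fip M M + 2 * fip M (H - Y) + fip (H - Y) (H - Y)"
    using Mc Hc Y by (simp add: fip_expand_add[of _ m l] minus_carrier_mat)
  moreover have "fip (Y - H) (Y - H) = fip (H - Y) (H - Y)"
    using frob_norm_minus_commute[OF Y Hc] by (simp flip: frob_norm_square)
  ultimately show ?thesis using cross unfolding M_def[symmetric] by (simp add: algebra_simps)
qed

section \<open>The constrained problem\<close>

text \<open>The matrix factors through the k + q columns of (A F). This is why the constrained
  solution is carried as \<open>A\<^sub>1 * T + F * G\<close>: the same form survives multiplication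
  by \<open>S\<close> and makes the competitor feasible.\<close>

lemma rank_append_cols_le:
  fixes A :: "'a :: field mat"
  assumes A: "A \<in> carrier_mat m k" and T: "T \<in> carrier_mat k l"
    and F: "F \<in> carrier_mat m q" and G: "G \<in> carrier_mat q l"
  shows "vec_space.rank m (append_cols A (A * T + F * G)) \<le> k + q"
proof -
  interpret vec_space "TYPE('a)" m .
  have AF: "append_cols A F \<in> carrier_mat m (k + q)" using A F by simp
  have "append_cols A F * four_block_mat (1\<^sub>m k) T (0\<^sub>m q k) G = append_cols A (A * T + F * G)"
    using A T F G by (subst append_cols_mult_four_block[of _ m k _ q _ k _ l]) auto
  then show ?thesis
    using rank_mult_le[OF AF, of "four_block_mat (1\<^sub>m k) T (0\<^sub>m q k) G" "k + l"] rank_le_nc[OF AF] T G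
    by (metis four_block_carrier_mat one_carrier_mat order_trans)
qed

text \<open>A left inverse is written down: \<open>L\<close> stacked on the transpose of
  \<open>N\<close> with rows rescaled by 1 / d_j. The mixed blocks vanish because \<open>N\<close>
  is orthogonal to \<open>A\<close> and annihilated by \<open>L\<close>.\<close>

lemma mat_inj_append_cols:
  fixes A N :: "real mat"
  assumes A: "A \<in> carrier_mat m k" and L: "L \<in> carrier_mat k m" and LA: "L * A = 1\<^sub>m k"
    and N: "N \<in> carrier_mat m p" and LN: "L * N = 0\<^sub>m k p" and NA: "N\<^sup>T * A = 0\<^sub>m p k"
    and NN: "N\<^sup>T * N = mat_diag p d" and d: "\<And>j. j < p \<Longrightarrow> d j \<noteq> 0"
  shows "mat_inj (append_cols A N)"
proof -
  define D where "D = mat_diag p (\<lambda>j. 1 / d j)"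
  have D: "D \<in> carrier_mat p p" by (simp add: D_def)
  have DNN: "D * (N\<^sup>T * N) = 1\<^sub>m p"
    unfolding NN D_def mat_diag_diag by (rule eq_matI) (auto simp: mat_diag_def d)
  have DN: "D * N\<^sup>T * A = 0\<^sub>m p k" "D * N\<^sup>T * N = 1\<^sub>m p"
    using D N A NA DNN by (simp_all add: assoc_mult_mat[of D p p "N\<^sup>T" m])
  let ?L = "four_block_mat L (0\<^sub>m k 0) (D * N\<^sup>T) (0\<^sub>m p 0)"
  have "?L * append_cols A N
    = four_block_mat (L * A + 0\<^sub>m k 0 * 0\<^sub>m 0 k) (L * N + 0\<^sub>m k 0 * 0\<^sub>m 0 p)
       (D * N\<^sup>T * A + 0\<^sub>m p 0 * 0\<^sub>m 0 k) (D * N\<^sup>T * N + 0\<^sub>m p 0 * 0\<^sub>m 0 p)"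
    unfolding append_cols_four_block[OF A N] using L A N D
    by (intro mult_four_block_mat[of _ k m _ 0 _ p]) auto
  also have "\<dots> = 1\<^sub>m (k + p)"
    unfolding LA LN DN by (rule eq_matI) auto
  finally have "?L * append_cols A N = 1\<^sub>m (k + p)" .
  moreover have "?L \<in> carrier_mat (k + p) m"
    using four_block_carrier_mat[OF L, of "0\<^sub>m p 0" p 0] by simp
  ultimately show ?thesis using A N by (intro mat_inj_if_left_inverse[of _ m "k + p"]) auto
qed

text \<open>
  The hypothesis \<open>rank\<close> bounds the number of independent columns in the column space of \<open>(A Z)\<close>.
  If the conclusion failed, the columns of \<open>A\<close> and the first \<open>q + 1\<close> columns of \<open>Y V\<close>, which are
  nonzero, pairwise orthogonal and orthogonal to \<open>A\<close>, would exceed it.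
\<close>

lemma projected_low_rank_tail:
  fixes A Z :: "real mat"
  assumes A: "A \<in> carrier_mat m k" and L: "L \<in> carrier_mat k m" and LA: "L * A = 1\<^sub>m k"
    and sym: "(A * L)\<^sup>T = A * L" and Z: "Z \<in> carrier_mat m l"
    and rank: "\<And>p C. C \<in> carrier_mat (k + l) p \<Longrightarrow> mat_inj (append_cols A Z * C) \<Longrightarrow> p \<le> k + q"
    and Y: "Y = Z - A * L * Z" and V: "V \<in> carrier_mat l l"
    and YV: "(Y * V)\<^sup>T * (Y * V) = mat_diag l d"
    and mono: "\<And>i j. i \<le> j \<Longrightarrow> j < l \<Longrightarrow> d j \<le> d i"
    and i: "i < m" and j: "q \<le> j" "j < l"
  shows "(Y * V) $$ (i, j) = 0"
proof -
  define P where "P = A * L"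
  have P: "P \<in> carrier_mat m m" and PT: "P\<^sup>T = P" using A L sym unfolding P_def by simp_all
  have LP: "L * P = L"
  proof -
    have "L * P = L * A * L" unfolding P_def using A L by (intro assoc_mult_mat[symmetric]) auto
    then show ?thesis using L unfolding LA by simp
  qed
  have PA: "P * A = A" using A L LA by (simp add: P_def)
  have Yc: "Y \<in> carrier_mat m l" using Z A L by (auto simp: Y intro: minus_carrier_mat)
  define M where "M = Y * V"
  have M: "M \<in> carrier_mat m l" using Yc V by (simp add: M_def)
  have gram: "(\<Sum>a<m. M $$ (a, x) * M $$ (a, y)) = (if x = y then d x else 0)"
    if "x < l" "y < l" for x y
  proof -
    have "(\<Sum>a<m. M $$ (a, x) * M $$ (a, y)) = (M\<^sup>T * M) $$ (x, y)"
      using M that by (simp add: scalar_prod_def lessThan_atLeast0)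
    also have "\<dots> = (if x = y then d x else 0)"
      using that YV by (simp add: M_def[symmetric]) (simp add: mat_diag_def)
    finally show ?thesis .
  qed
  have "d j = 0"
  proof (rule ccontr)
    assume "d j \<noteq> 0"
    moreover have "0 \<le> (\<Sum>a<m. M $$ (a, j) * M $$ (a, j))" by (intro sum_nonneg) simp
    ultimately have dj: "0 < d j" unfolding gram[OF j(2) j(2)] by simp
    have pos: "d a \<noteq> 0" if "a < q + 1" for a
    proof -
      have "d j \<le> d a" using that j by (intro mono) auto
      then show ?thesis using dj by simp
    qed
    \<comment> \<open>The first q + 1 columns of \<open>V\<close>, which exist because q \<le> j <
      l.\<close>
    define K where "K = mat l (q + 1) (\<lambda>(a, b). V $$ (a, b))"
    have K: "K \<in> carrier_mat l (q + 1)" by (simp add: K_def)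
    define N where "N = Y * K"
    have N: "N \<in> carrier_mat m (q + 1)" using Yc K by (simp add: N_def)
    have NM: "N $$ (a, b) = M $$ (a, b)" if "a < m" "b < q + 1" for a b
      using that j Yc V unfolding N_def M_def K_def by (simp add: scalar_prod_def)
    have NN: "N\<^sup>T * N = mat_diag (q + 1) d"
    proof (rule eq_matI)
      fix a b assume "a < dim_row (mat_diag (q + 1) d)" "b < dim_col (mat_diag (q + 1) d)"
      then have ab: "a < q + 1" "b < q + 1" by (auto simp: mat_diag_def)
      then have "(N\<^sup>T * N) $$ (a, b) = (\<Sum>x<m. M $$ (x, a) * M $$ (x, b))"
        using N by (simp add: scalar_prod_def lessThan_atLeast0 NM)
      then show "(N\<^sup>T * N) $$ (a, b) = mat_diag (q + 1) d $$ (a, b)"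
        using gram[of a b] ab j by (simp add: mat_diag_def)
    qed (use N in \<open>auto simp: mat_diag_def\<close>)
    have "P * Y = P * Z - P * (P * Z)"
      using P Z unfolding Y P_def[symmetric] by (intro mult_minus_distrib_mat[of _ m m]) auto
    also have "P * (P * Z) = P * P * Z" using P Z by (intro assoc_mult_mat[symmetric]) auto
    also have "P * P = P"
    proof -
      have "P * (A * L) = P * A * L" using A L P by (intro assoc_mult_mat[symmetric]) auto
      then show ?thesis unfolding PA unfolding P_def .
    qed
    finally have PY: "P * Y = 0\<^sub>m m l" using P Z by simp
    have PN: "P * N = 0\<^sub>m m (q + 1)"
    proof -
      have "P * N = P * Y * K"
        unfolding N_def using P Yc K by (intro assoc_mult_mat[symmetric]) auto
      then show ?thesis using K unfolding PY by simp
    qed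
    have LN: "L * N = 0\<^sub>m k (q + 1)"
    proof -
      have "L * N = L * P * N" by (simp add: LP)
      also have "\<dots> = L * (P * N)" using L P N by (intro assoc_mult_mat) auto
      finally show ?thesis using L unfolding PN by simp
    qed
    have NA: "N\<^sup>T * A = 0\<^sub>m (q + 1) k"
    proof -
      have "N\<^sup>T * A = N\<^sup>T * (P * A)" by (simp add: PA)
      also have "\<dots> = N\<^sup>T * P * A" using N P A by (intro assoc_mult_mat[symmetric]) auto
      also have "N\<^sup>T * P = (P * N)\<^sup>T" using transpose_mult[OF P N] PT by simp
      finally show ?thesis using A unfolding PN by simp
    qed
    \<comment> \<open>Chosen so that \<open>A * ?X + Z * K\<close> is \<open>Z * K\<close> minus its
      projection, namely \<open>N\<close>. Thus (A N) arises from (A Z) by column operations, as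
      \<open>rank\<close> requires.\<close>
    let ?X = "- (L * Z * K)"
    have X: "?X \<in> carrier_mat k (q + 1)" using L Z K by simp
    have "append_cols A Z * four_block_mat (1\<^sub>m k) ?X (0\<^sub>m l k) K
      = append_cols (A * 1\<^sub>m k + Z * 0\<^sub>m l k) (A * ?X + Z * K)"
      using A Z X K by (intro append_cols_mult_four_block) auto
    also have "A * 1\<^sub>m k + Z * 0\<^sub>m l k = A" using A Z by simp
    also have "A * ?X + Z * K = N"
    proof -
      have "N = Z * K - P * Z * K"
        unfolding N_def Y P_def[symmetric] using Z P K by (intro minus_mult_distrib_mat[of _ m l]) auto
      moreover have "P * Z * K = A * (L * Z * K)"
        using A L Z K unfolding P_def
        by (simp add: assoc_mult_mat[of A m k L m Z l] assoc_mult_mat[of A m k "L * Z" l K "q + 1"])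
      moreover have "A * ?X = - (A * (L * Z * K))"
        using A L Z K by (intro uminus_mult_right_mat) auto
      moreover have "- M1 + M2 = M2 - M1" if "M1 \<in> carrier_mat m (q + 1)" "M2 \<in> carrier_mat m (q + 1)"
        for M1 M2 :: "real mat"
        using that by (intro eq_matI) auto
      ultimately show ?thesis using A L Z K by simp
    qed
    finally have "append_cols A Z * four_block_mat (1\<^sub>m k) ?X (0\<^sub>m l k) K = append_cols A N" .
    moreover have "mat_inj (append_cols A N)"
      by (rule mat_inj_append_cols[OF A L LA N LN NA NN pos])
    moreover have "four_block_mat (1\<^sub>m k) ?X (0\<^sub>m l k) K \<in> carrier_mat (k + l) (k + (q + 1))"
      using K by (intro four_block_carrier_mat) auto
    ultimately have "k + (q + 1) \<le> k + q" by (metis rank)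
    then show False by simp
  qed
  then have "(\<Sum>a<m. M $$ (a, j) * M $$ (a, j)) = 0" using gram[OF j(2) j(2)] by simp
  then show ?thesis
    using i unfolding M_def[symmetric] by (subst (asm) sum_nonneg_eq_0_iff) auto
qed

text \<open>A symmetric \<open>P\<close> moves across the inner product, so \<open>P * X\<close> is
  orthogonal to every \<open>Y\<close> with \<open>P * Y = 0\<^sub>m m l\<close>.\<close>

lemma fip_projection_Pythagoras:
  assumes P: "P \<in> carrier_mat m m" and PT: "P\<^sup>T = P" and X: "X \<in> carrier_mat m l"
    and Y: "Y \<in> carrier_mat m l" and PY: "P * Y = 0\<^sub>m m l"
  shows "fip (P * X + Y) (P * X + Y) = fip (P * X) (P * X) + fip Y Y"
proof -
  have "fip (P * X) Y = 0"
    using fip_mult_left[OF P X Y] X unfolding PT PY by (simp add: fip_def)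
  then show ?thesis using P X Y by (simp add: fip_expand_add[of _ m l])
qed

text \<open>The projection \<open>P\<close> onto the column space of \<open>A\<^sub>1\<close> splits
  both distances. The part inside that space is the same on both sides, while the part outside is a
  low-rank approximation of \<open>B\<close> by the projected \<open>Z\<close>. The rank condition
  on \<open>Z\<close> speaks of injective products because that form can be checked after
  multiplying (A_1 Z) by an injective matrix from the left.\<close>

lemma constrained_approximation:
  fixes A\<^sub>1 A\<^sub>2 :: "real mat"
  assumes A1: "A\<^sub>1 \<in> carrier_mat m k" and A2: "A\<^sub>2 \<in> carrier_mat m l" and inj: "mat_inj A\<^sub>1"
    and q: "q \<le> l" and gap: "sing_val (proj_perp A\<^sub>1 A\<^sub>2) q > sing_val (proj_perp A\<^sub>1 A\<^sub>2) (q + 1)"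
  obtains c T F G where "0 < c" "T \<in> carrier_mat k l" "F \<in> carrier_mat m q" "G \<in> carrier_mat q l"
    "\<And>Z. Z \<in> carrier_mat m l \<Longrightarrow>
      (\<And>p C. C \<in> carrier_mat (k + l) p \<Longrightarrow> mat_inj (append_cols A\<^sub>1 Z * C) \<Longrightarrow> p \<le> k + q) \<Longrightarrow>
      fip (A\<^sub>2 - (A\<^sub>1 * T + F * G)) (A\<^sub>2 - (A\<^sub>1 * T + F * G))
        + c * fip (Z - (A\<^sub>1 * T + F * G)) (Z - (A\<^sub>1 * T + F * G)) \<le> fip (A\<^sub>2 - Z) (A\<^sub>2 - Z)"
proof -
  obtain L where L: "L \<in> carrier_mat k m" and LA: "L * A\<^sub>1 = 1\<^sub>m k" and sym: "(A\<^sub>1 * L)\<^sup>T = A\<^sub>1 * L"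
    using left_inverse_symmetric_projection[OF A1 inj] by blast
  define P where "P = A\<^sub>1 * L"
  have P: "P \<in> carrier_mat m m" and PT: "P\<^sup>T = P" using A1 L sym by (auto simp: P_def)
  have PP: "P * P = P"
  proof -
    have "P * P = A\<^sub>1 * (L * A\<^sub>1 * L)"
      unfolding P_def using A1 L
      by (simp add: assoc_mult_mat[of A\<^sub>1 m k L m "A\<^sub>1 * L" m] assoc_mult_mat[of L k m A\<^sub>1 k L m])
    then show ?thesis using L by (simp add: LA P_def)
  qed
  have Pperp: "P * (X - P * X) = 0\<^sub>m m l" if "X \<in> carrier_mat m l" for X
  proof -
    have "P * (X - P * X) = P * X - P * (P * X)"
      using P that by (intro mult_minus_distrib_mat[of _ m m]) auto
    also have "P * (P * X) = P * P * X" using P that by (intro assoc_mult_mat[symmetric]) auto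
    finally show ?thesis using P that unfolding PP by simp
  qed
  define B where "B = A\<^sub>2 - P * A\<^sub>2"
  have B: "B \<in> carrier_mat m l" using A2 P by (auto simp: B_def intro: minus_carrier_mat)
  have PB: "P * B = 0\<^sub>m m l" unfolding B_def by (rule Pperp[OF A2])
  have perp: "proj_perp A\<^sub>1 A\<^sub>2 = B"
    unfolding B_def P_def by (rule proj_perp_eq[OF A1 L LA sym A2])
  obtain es U where len: "length es = l" and sorted: "sorted_wrt (\<ge>) es"
    and nonneg: "\<forall>e\<in>set es. 0 \<le> e" and cp: "char_poly (B\<^sup>T * B) = (\<Prod>e\<leftarrow>es. [:- e, 1:])"
    and U: "U \<in> carrier_mat l l" and UU: "U\<^sup>T * U = 1\<^sub>m l"
    and BU: "(B * U)\<^sup>T * (B * U) = mat_diag l (\<lambda>i. es ! i)"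
    by (rule gram_spectral_decomposition[OF B])
  have UU': "U * U\<^sup>T = 1\<^sub>m l" using mat_mult_left_right_inverse[OF _ U UU] U by simp
  have "es ! q < es ! (q - 1)" if "0 < q" "q < length es"
    using gap that unfolding perp sing_val_eq[OF cp sorted nonneg] by simp
  then obtain t \<theta> where t: "1 < t" and low: "\<And>j. j < q \<Longrightarrow> \<theta> \<le> es ! j"
    and high: "\<And>j. q \<le> j \<Longrightarrow> j < l \<Longrightarrow> t\<^sup>2 * es ! j \<le> \<theta>"
    using gap_threshold[OF sorted nonneg] q len by metis
  \<comment> \<open>The truncation in factored form: the first q columns of \<open>B * U\<close>
    times the first q rows of the transpose of \<open>U\<close>. \<open>H'\<close> is the same
    matrix in rotated coordinates.\<close>
  define F where "F = mat m q (\<lambda>(i, j). (B * U) $$ (i, j))"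
  define G where "G = mat q l (\<lambda>(i, j). U $$ (j, i))"
  define H' where "H' = B * U * mat_diag l (\<lambda>j. if j < q then 1 else 0)"
  define H where "H = F * G"
  define T where "T = L * A\<^sub>2"
  define c where "c = 1 - 1 / t"
  have c: "0 < c" "c \<le> 1" using t by (auto simp: c_def)
  have F: "F \<in> carrier_mat m q" and G: "G \<in> carrier_mat q l" and T: "T \<in> carrier_mat k l"
    using L A2 by (auto simp: F_def G_def T_def)
  have H: "H \<in> carrier_mat m l" using F G by (simp add: H_def)
  have BUc: "B * U \<in> carrier_mat m l" using B U by simp
  have H'c: "H' \<in> carrier_mat m l" using BUc by (simp add: H'_def)
  have H'i: "H' = mat m l (\<lambda>(i, j). (B * U) $$ (i, j) * (if j < q then 1 else 0))"
    unfolding H'_def by (rule mat_diag_mult_right[OF BUc])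
  have HU: "H = H' * U\<^sup>T"
  proof (rule eq_matI)
    fix i j assume "i < dim_row (H' * U\<^sup>T)" "j < dim_col (H' * U\<^sup>T)"
    then have i: "i < m" and j: "j < l" using H'c U by auto
    define M where "M = B * U"
    have "H $$ (i, j) = (\<Sum>a<q. M $$ (i, a) * U $$ (j, a))"
      using i j F G unfolding H_def F_def G_def M_def[symmetric]
      by (simp add: scalar_prod_def lessThan_atLeast0)
    also have "\<dots> = (\<Sum>a<l. M $$ (i, a) * (if a < q then 1 else 0) * U $$ (j, a))"
      using q by (intro sum.mono_neutral_cong_left) auto
    also have "\<dots> = (H' * U\<^sup>T) $$ (i, j)"
      using i j U unfolding H'i M_def[symmetric] by (simp add: scalar_prod_def lessThan_atLeast0)
    finally show "H $$ (i, j) = (H' * U\<^sup>T) $$ (i, j)" .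
  qed (use H H'c U in auto)
  have HU': "H * U = H'"
    using H'c U UU by (simp add: HU assoc_mult_mat[of H' m l "U\<^sup>T" l U l])
  have PH: "P * H = 0\<^sub>m m l"
  proof -
    let ?D = "mat_diag l (\<lambda>j. if j < q then 1 else 0) * U\<^sup>T"
    have "H = B * (U * ?D)"
      using B U unfolding HU H'_def
      by (simp add: assoc_mult_mat[of _ m l _ l _ l] assoc_mult_mat[of _ l l _ l _ l])
    then have "P * H = P * (B * (U * ?D))" by simp
    also have "\<dots> = P * B * (U * ?D)"
      using P B U by (intro assoc_mult_mat[symmetric]) auto
    finally have "P * H = P * B * (U * ?D)" .
    then show ?thesis using U unfolding PB by simp
  qed
  have A2': "A\<^sub>1 * T + F * G = P * A\<^sub>2 + H"
    using A1 L A2 by (simp add: T_def H_def P_def assoc_mult_mat[of A\<^sub>1 m k L m A\<^sub>2 l])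
  show thesis
  proof (rule that[OF c(1) T F G])
    fix Z assume Z: "Z \<in> carrier_mat m l"
      and rank: "\<And>p C. C \<in> carrier_mat (k + l) p \<Longrightarrow> mat_inj (append_cols A\<^sub>1 Z * C) \<Longrightarrow> p \<le> k + q"
    define Y where "Y = Z - P * Z"
    have Y: "Y \<in> carrier_mat m l" using Z P by (auto simp: Y_def intro: minus_carrier_mat)
    have PY: "P * Y = 0\<^sub>m m l" unfolding Y_def by (rule Pperp[OF Z])
    obtain fs V where lenf: "length fs = l" and sortedf: "sorted_wrt (\<ge>) fs"
      and V: "V \<in> carrier_mat l l" and VV: "V\<^sup>T * V = 1\<^sub>m l"
      and YV: "(Y * V)\<^sup>T * (Y * V) = mat_diag l (\<lambda>i. fs ! i)"
      by (rule gram_spectral_decomposition[OF Y])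
    have tail: "(Y * V) $$ (i, j) = 0" if "i < m" "q \<le> j" "j < l" for i j
    proof (rule projected_low_rank_tail[OF A1 L LA sym Z rank _ V YV _ that])
      show "Y = Z - A\<^sub>1 * L * Z" by (simp add: Y_def P_def)
      show "fs ! j \<le> fs ! i" if "i \<le> j" "j < l" for i j
        using sortedf that lenf by (cases "i = j") (auto simp: sorted_wrt_iff_nth_less)
    qed
    \<comment> \<open>Passing to \<open>Y * U\<close> requires replacing \<open>V\<close> by
      \<open>U\<^sup>T * V\<close>, so that the product, and with it the vanishing tail, stays the
      same.\<close>
    have YU: "Y * U \<in> carrier_mat m l" and UV: "U\<^sup>T * V \<in> carrier_mat l l" using Y U V by auto
    have "Y * U * (U\<^sup>T * V) = Y * (U * U\<^sup>T) * V"
      using Y U V by (simp add: assoc_mult_mat[of _ m l _ l _ l] assoc_mult_mat[of _ l l _ l _ l])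
    then have YUUV: "Y * U * (U\<^sup>T * V) = Y * V" using Y unfolding UU' by simp
    have UVUV: "(U\<^sup>T * V)\<^sup>T * (U\<^sup>T * V) = 1\<^sub>m l"
      using gram_mat_mult[of "U\<^sup>T" l l V l] U V UU' VV by simp
    have "fip (B * U - H') (B * U - H') + (1 - 1 / t) * fip (Y * U - H') (Y * U - H')
      \<le> fip (B * U - Y * U) (B * U - Y * U)"
      by (rule diagonal_truncation_growth[OF BUc BU YU UV UVUV _ t low high H'_def])
        (use tail in \<open>simp_all only: YUUV\<close>)
    moreover have "fip (X * U - X' * U) (X * U - X' * U) = fip (X - X') (X - X')"
      if "X \<in> carrier_mat m l" "X' \<in> carrier_mat m l" for X X'
      using fip_mult_orthogonal[of "X - X'" m l U] that U UU
      by (simp add: minus_mult_distrib_mat[of X m l X' U l] minus_carrier_mat)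
    ultimately have growth: "fip (B - H) (B - H) + c * fip (Y - H) (Y - H) \<le> fip (B - Y) (B - Y)"
      unfolding HU'[symmetric] c_def using B H Y by simp
    have PBY: "P * (B - Y) = 0\<^sub>m m l" and PYH: "P * (Y - H) = 0\<^sub>m m l"
      unfolding mult_minus_distrib_mat[OF P B Y] mult_minus_distrib_mat[OF P Y H] PB PY PH by simp_all
    have dist: "P * (A\<^sub>2 - Z) = P * A\<^sub>2 - P * Z" "P * (Z - A\<^sub>2) = P * Z - P * A\<^sub>2"
      by (rule mult_minus_distrib_mat[OF P A2 Z], rule mult_minus_distrib_mat[OF P Z A2])
    have PA2: "P * A\<^sub>2 \<in> carrier_mat m l" and PZ: "P * Z \<in> carrier_mat m l" using P A2 Z by auto
    have diff_add: "M - (N + K) = M - N - K" "M - (N + K) = (M' - N) + (M - M' - K)"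
      "M - N = (K - M') + (M - K - (N - M'))"
      if "M \<in> carrier_mat m l" "N \<in> carrier_mat m l" "K \<in> carrier_mat m l" "M' \<in> carrier_mat m l"
      for M N K M' :: "real mat"
      using that by (intro eq_matI; simp)+
    have e1: "A\<^sub>2 - (P * A\<^sub>2 + H) = B - H"
      unfolding B_def by (rule diff_add(1)[OF A2 PA2 H A2])
    have e2: "Z - (P * A\<^sub>2 + H) = P * (Z - A\<^sub>2) + (Y - H)"
      unfolding Y_def dist by (rule diff_add(2)[OF Z PA2 H PZ])
    have e3: "A\<^sub>2 - Z = P * (A\<^sub>2 - Z) + (B - Y)"
      unfolding Y_def B_def dist by (rule diff_add(3)[OF A2 Z PA2 PZ])
    have f2: "fip (Z - (P * A\<^sub>2 + H)) (Z - (P * A\<^sub>2 + H))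
      = fip (P * (Z - A\<^sub>2)) (P * (Z - A\<^sub>2)) + fip (Y - H) (Y - H)"
      unfolding e2 using A2 Z Y H PYH
      by (intro fip_projection_Pythagoras[OF P PT]) (auto intro: minus_carrier_mat)
    have f3: "fip (A\<^sub>2 - Z) (A\<^sub>2 - Z)
      = fip (P * (A\<^sub>2 - Z)) (P * (A\<^sub>2 - Z)) + fip (B - Y) (B - Y)"
      by (subst (1 2) e3, rule fip_projection_Pythagoras[OF P PT])
        (use A2 Z Y B PBY in \<open>auto intro: minus_carrier_mat\<close>)
    have f4: "fip (P * (A\<^sub>2 - Z)) (P * (A\<^sub>2 - Z)) = fip (P * (Z - A\<^sub>2)) (P * (Z - A\<^sub>2))"
      unfolding dist using frob_norm_minus_commute[OF PA2 PZ] by (simp flip: frob_norm_square)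
    \<comment> \<open>The part inside the column space grows with coefficient 1, and c = 1 - 1 / t
      is at most 1.\<close>
    have "c * fip (P * (Z - A\<^sub>2)) (P * (Z - A\<^sub>2)) \<le> fip (P * (Z - A\<^sub>2)) (P * (Z - A\<^sub>2))"
      using c by (intro mult_left_le_one_le) (auto simp flip: frob_norm_square)
    then show "fip (A\<^sub>2 - (A\<^sub>1 * T + F * G)) (A\<^sub>2 - (A\<^sub>1 * T + F * G))
        + c * fip (Z - (A\<^sub>1 * T + F * G)) (Z - (A\<^sub>1 * T + F * G)) \<le> fip (A\<^sub>2 - Z) (A\<^sub>2 - Z)"
      using growth unfolding A2' f2 f3 f4 e1 by (simp add: algebra_simps)
  qed
qed

section \<open>Perturbation of the first block\<close>

text \<open>Here \<open>R\<close> is the residual of the limit, \<open>D\<close> the error after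
  undoing \<open>S\<close>, and \<open>G\<close>, \<open>K\<close> are the images of the limit and
  of \<open>D\<close> under \<open>S\<close> minus the identity. Adding \<open>growth\<close> and
  \<open>opt\<close> cancels \<open>fip R G\<close> and \<open>fip G G\<close>; each surviving upper
  bound has a factor \<open>frob_norm D\<close>.\<close>

lemma perturbation_bound:
  assumes R: "R \<in> carrier_mat m l" and D: "D \<in> carrier_mat m l"
    and G: "G \<in> carrier_mat m l" and K: "K \<in> carrier_mat m l" and c: "0 < c"
    and growth: "fip R R + c * fip D D \<le> fip (R - D) (R - D)"
    and opt: "fip (R - D - (G + K)) (R - D - (G + K)) \<le> fip (R - G) (R - G)"
    and normG: "frob_norm G \<le> \<epsilon> * a" and normK: "frob_norm K \<le> \<epsilon> * frob_norm D"
    and \<epsilon>: "0 \<le> \<epsilon>" "\<epsilon> \<le> 1 / 2" "\<epsilon> \<le> c / 4" and a: "0 \<le> a"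
  shows "frob_norm D \<le> \<epsilon> * ((4 * frob_norm R + 6 * a) / c)"
proof -
  define \<delta> where "\<delta> = frob_norm D"
  define \<rho> where "\<rho> = frob_norm R"
  have nn: "0 \<le> \<delta>" "0 \<le> \<rho>" by (auto simp: \<delta>_def \<rho>_def)
  note sums = fip_diff_left[of _ m l] fip_diff_right[of _ m l] fip_add_left[of _ m l]
    fip_add_right[of _ m l] minus_carrier_mat
  have "fip (R - D - (G + K)) (R - D - (G + K)) = fip (R - D) (R - D) - 2 * fip R G - 2 * fip R K
    + 2 * fip D G + 2 * fip D K + fip G G + 2 * fip G K + fip K K"
    using R D G K fip_commute[OF G R] fip_commute[OF K R] fip_commute[OF G D] fip_commute[OF K D]
      fip_commute[OF K G] fip_commute[OF D R]
    by (simp add: sums)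
  moreover have "fip (R - G) (R - G) = fip R R - 2 * fip R G + fip G G"
    using R G fip_commute[OF G R] by (simp add: sums)
  moreover have "0 \<le> fip K K" by (simp flip: frob_norm_square)
  ultimately have "c * fip D D \<le> 2 * fip R K - 2 * fip D G - 2 * fip D K - 2 * fip G K"
    using growth opt by linarith
  moreover have "fip R K \<le> \<rho> * (\<epsilon> * \<delta>)"
    using fip_Cauchy_Schwarz[OF R K] mult_left_mono[OF normK nn(2)] by (simp add: \<delta>_def \<rho>_def)
  moreover have "- fip D G \<le> \<delta> * (\<epsilon> * a)"
    using fip_Cauchy_Schwarz[OF D G] mult_left_mono[OF normG nn(1)] by (simp add: \<delta>_def)
  moreover have "- fip D K \<le> \<delta> * (\<epsilon> * \<delta>)"
    using fip_Cauchy_Schwarz[OF D K] mult_left_mono[OF normK nn(1)] by (simp add: \<delta>_def)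
  moreover have "- fip G K \<le> (\<epsilon> * a) * (\<epsilon> * \<delta>)"
    using fip_Cauchy_Schwarz[OF G K] mult_mono[OF normG normK] \<epsilon> a nn by (simp add: \<delta>_def)
  moreover have "fip D D = \<delta> * \<delta>" by (simp add: \<delta>_def power2_eq_square flip: frob_norm_square)
  ultimately have main: "c * \<delta> * \<delta> \<le> (2 * \<rho> * \<epsilon> + 2 * \<epsilon> * a + 2 * \<epsilon> * \<delta> + 2 * \<epsilon> * a * \<epsilon>) * \<delta>"
    by (simp add: algebra_simps)
  have "\<delta> \<le> \<epsilon> * ((4 * \<rho> + 6 * a) / c)"
  proof (cases "\<delta> = 0")
    case True
    then show ?thesis using \<epsilon> a c nn by simp
  next
    case False
    then have "0 < \<delta>" using nn by simp
    then have "c * \<delta> \<le> 2 * \<rho> * \<epsilon> + 2 * \<epsilon> * a + 2 * \<epsilon> * \<delta> + 2 * \<epsilon> * a * \<epsilon>"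
      using main by (simp only: mult_le_cancel_right_pos)
    \<comment> \<open>The bound c / 4 on \<epsilon> lets the left side absorb this term at the price
      of half of it. The term quadratic in \<epsilon> costs another \<epsilon> a, leaving c / 2
      times \<delta> below \<epsilon> (2 \<rho> + 3 a), whence the constants 4 and 6.\<close>
    moreover have "2 * \<epsilon> * \<delta> \<le> c / 2 * \<delta>"
      using \<epsilon> nn by (intro mult_right_mono) auto
    moreover have "2 * \<epsilon> * a * \<epsilon> \<le> \<epsilon> * a"
      using mult_left_mono[OF \<epsilon>(2), of "2 * \<epsilon> * a"] \<epsilon>(1) a by simp
    ultimately have "c * \<delta> \<le> \<epsilon> * (4 * \<rho> + 6 * a)" by (simp add: algebra_simps)
    then show ?thesis using c by (simp add: field_simps)
  qed
  then show ?thesis by (simp add: \<delta>_def \<rho>_def)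
qed

text \<open>A kernel vector satisfies E v = - v, so its length is at most \<open>frob_norm E\<close>
  times itself. Writing v as a one-column matrix makes \<open>frob_norm_mult\<close>
  applicable.\<close>

lemma mat_inj_one_plus_small:
  fixes E :: "real mat"
  assumes E: "E \<in> carrier_mat m m" and small: "frob_norm E < 1"
  shows "mat_inj (1\<^sub>m m + E)"
proof -
  have "v = 0\<^sub>v m" if v: "v \<in> carrier_vec m" and 0: "(1\<^sub>m m + E) *\<^sub>v v = 0\<^sub>v m" for v
  proof -
    define M where "M = mat m 1 (\<lambda>(i, _). v $ i)"
    have M: "M \<in> carrier_mat m 1" by (simp add: M_def)
    have "(E * M) $$ (i, 0) = - M $$ (i, 0)" if i: "i < m" for i
    proof -
      have "v $ i + (E *\<^sub>v v) $ i = ((1\<^sub>m m + E) *\<^sub>v v) $ i"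
        using i v E by (simp add: add_mult_distrib_mat_vec[of _ m m])
      also have "\<dots> = 0" unfolding 0 using i by simp
      finally have "(E *\<^sub>v v) $ i = - v $ i" by simp
      moreover have "(E * M) $$ (i, 0) = (E *\<^sub>v v) $ i"
        using i E v by (simp add: M_def scalar_prod_def)
      ultimately show ?thesis using i by (simp add: M_def)
    qed
    then have "frob_norm (E * M) = frob_norm M"
      using E M by (simp add: frob_norm_def del: index_mult_mat(1))
    then have "frob_norm M \<le> frob_norm E * frob_norm M" using frob_norm_mult[OF E M] by simp
    then have "frob_norm M = 0"
      using small frob_norm_nonneg[of M] by (metis less_le_not_le mult_left_le_one_le mult_le_cancel_right1 order_antisym_conv)
    then have M0: "M = 0\<^sub>m m 1" by (rule frob_norm_eq_0[OF M])
    show "v = 0\<^sub>v m"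
    proof (rule eq_vecI)
      fix i assume "i < dim_vec (0\<^sub>v m :: real vec)"
      then have i: "i < m" by simp
      then have "v $ i = M $$ (i, 0)" by (simp add: M_def)
      then show "v $ i = 0\<^sub>v m $ i" using i unfolding M0 by simp
    qed (use v in simp)
  qed
  then show ?thesis using E unfolding mat_inj_def by simp
qed

section \<open>Block form of the costs and comparison with the smallest weight\<close>

lemma weighted_cost_ones:
  assumes A1: "A\<^sub>1 \<in> carrier_mat m k" and A2: "A\<^sub>2 \<in> carrier_mat m l" and W: "W\<^sub>1 \<in> carrier_mat m k"
    and X1: "X\<^sub>1 \<in> carrier_mat m k" and X2: "X\<^sub>2 \<in> carrier_mat m l"
  shows "weighted_cost A\<^sub>1 A\<^sub>2 W\<^sub>1 (all_ones m l) (X\<^sub>1, X\<^sub>2)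
    = fip ((A\<^sub>1 - X\<^sub>1) \<odot>\<^sub>H W\<^sub>1) ((A\<^sub>1 - X\<^sub>1) \<odot>\<^sub>H W\<^sub>1) + fip (A\<^sub>2 - X\<^sub>2) (A\<^sub>2 - X\<^sub>2)"
proof -
  have one: "all_ones m l \<in> carrier_mat m l" by (simp add: all_ones_def)
  have c: "A\<^sub>1 - X\<^sub>1 \<in> carrier_mat m k" "A\<^sub>2 - X\<^sub>2 \<in> carrier_mat m l"
    using X1 X2 by (auto intro: minus_carrier_mat)
  have h: "(A\<^sub>1 - X\<^sub>1) \<odot>\<^sub>H W\<^sub>1 \<in> carrier_mat m k"
    using X1 unfolding hadamard_def by simp
  have id: "(A\<^sub>2 - X\<^sub>2) \<odot>\<^sub>H all_ones m l = A\<^sub>2 - X\<^sub>2"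
    by (rule eq_matI) (use X2 in \<open>auto simp: hadamard_def all_ones_def\<close>)
  show ?thesis
    unfolding weighted_cost_def prod.case append_cols_diff[OF A1 A2 X1 X2]
      append_cols_hadamard[OF c W one] frob_norm_square id fip_append_cols[OF h c(2)] ..
qed

lemma plain_cost_same_first:
  assumes A1: "A\<^sub>1 \<in> carrier_mat m k" and A2: "A\<^sub>2 \<in> carrier_mat m l" and Z: "Z \<in> carrier_mat m l"
  shows "plain_cost A\<^sub>1 A\<^sub>2 (A\<^sub>1, Z) = fip (A\<^sub>2 - Z) (A\<^sub>2 - Z)"
proof -
  have c: "A\<^sub>1 - A\<^sub>1 \<in> carrier_mat m k" "A\<^sub>2 - Z \<in> carrier_mat m l"
    using A1 Z by (auto intro: minus_carrier_mat)
  have "fip (A\<^sub>1 - A\<^sub>1) (A\<^sub>1 - A\<^sub>1) = 0" using A1 by (simp add: fip_def)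
  then show ?thesis
    unfolding plain_cost_def prod.case append_cols_diff[OF A1 A2 A1 Z] frob_norm_square
      fip_append_cols[OF c] by simp
qed

lemma min_entry_le:
  assumes "W \<in> carrier_mat m k" "i < m" "j < k"
  shows "min_entry W \<le> W $$ (i, j)"
proof -
  have "{W $$ (i, j) | i j. i < dim_row W \<and> j < dim_col W}
    = (\<lambda>(i, j). W $$ (i, j)) ` ({..<dim_row W} \<times> {..<dim_col W})" by auto
  then have "finite {W $$ (i, j) | i j. i < dim_row W \<and> j < dim_col W}" by simp
  then show ?thesis unfolding min_entry_def using assms by (intro Min_le) auto
qed

lemma hadamard_min_entry_bound:
  assumes X: "X \<in> carrier_mat m k" and W: "W \<in> carrier_mat m k" and pos: "0 \<le> min_entry W"
  shows "(min_entry W * frob_norm X)\<^sup>2 \<le> fip (X \<odot>\<^sub>H W) (X \<odot>\<^sub>H W)"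
proof -
  have "(min_entry W)\<^sup>2 * (\<Sum>i<m. \<Sum>j<k. (X $$ (i, j))\<^sup>2)
    \<le> (\<Sum>i<m. \<Sum>j<k. (X $$ (i, j) * W $$ (i, j))\<^sup>2)"
    unfolding sum_distrib_left power_mult_distrib
    by (intro sum_mono) (use min_entry_le[OF W] pos in \<open>auto simp: mult.commute intro!: mult_right_mono power_mono\<close>)
  then show ?thesis
    using X by (simp add: power_mult_distrib frob_norm_square)
      (simp add: fip_def hadamard_def power2_eq_square mult_ac)
qed

text \<open>An injective left factor preserves injectivity of M C, so p is the rank of S M C, which
  is at most that of S M. It carries the rank bound from (X_1 X_2) to (A_1 Z) with Z the preimage of
  X_2 under S.\<close>

lemma inj_factor_le_rank:
  fixes S M N :: "'a :: field mat"
  assumes S: "S \<in> carrier_mat m m" and inj: "mat_inj S" and M: "M \<in> carrier_mat m n"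
    and C: "C \<in> carrier_mat n p" and MC: "mat_inj (M * C)"
  shows "p \<le> vec_space.rank m (S * M)"
proof -
  have "mat_inj (S * M * C)"
    unfolding mat_inj_def
  proof (intro ballI impI)
    fix v assume "v \<in> carrier_vec (dim_col (S * M * C))" "S * M * C *\<^sub>v v = 0\<^sub>v (dim_row (S * M * C))"
    then have v: "v \<in> carrier_vec p" and 0: "S * M * C *\<^sub>v v = 0\<^sub>v m" using S C by auto
    have "S *\<^sub>v ((M * C) *\<^sub>v v) = S * (M * C) *\<^sub>v v"
      using S M C v by (intro assoc_mult_mat_vec[symmetric]) auto
    also have "S * (M * C) = S * M * C" using S M C by (intro assoc_mult_mat[symmetric]) auto
    finally have "S *\<^sub>v ((M * C) *\<^sub>v v) = 0\<^sub>v m" unfolding 0 .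
    moreover have "(M * C) *\<^sub>v v \<in> carrier_vec m" using M C v by (intro mult_mat_vec_carrier) auto
    ultimately have "(M * C) *\<^sub>v v = 0\<^sub>v m" using inj S unfolding mat_inj_def by auto
    then have "v = 0\<^sub>v p" using MC M C v unfolding mat_inj_def by auto
    then show "v = 0\<^sub>v (dim_col (S * M * C))" using C by simp
  qed
  then have "vec_space.rank m (S * M * C) = p"
    using S M C by (intro rank_mat_inj) auto
  then show ?thesis using rank_mult_le[of "S * M" m n C p] S M C by simp
qed

lemma mat_eq_if_frob_norm_diff_0:
  assumes A: "A \<in> carrier_mat m n" and B: "B \<in> carrier_mat m n" and 0: "frob_norm (A - B) = 0"
  shows "A = B"
proof -
  have diff: "A - B = 0\<^sub>m m n" using B 0 by (intro frob_norm_eq_0 minus_carrier_mat)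
  show ?thesis
  proof (rule eq_matI)
    fix i j assume "i < dim_row B" "j < dim_col B"
    then have "A $$ (i, j) - B $$ (i, j) = (A - B) $$ (i, j)" using A B by simp
    then show "A $$ (i, j) = B $$ (i, j)"
      using \<open>i < _\<close> \<open>j < _\<close> B unfolding diff by simp
  qed (use A B in auto)
qed

section \<open>Uniqueness in the limit problem and the uniform rate\<close>

theorem theorem2p1:
  fixes m n k r :: nat and A\<^sub>1 A\<^sub>2 :: "real mat"
  assumes "A\<^sub>1 \<in> carrier_mat m k"
    and "A\<^sub>2 \<in> carrier_mat m (n - k)"
    and "1 \<le> k"
    and "vec_space.rank m A\<^sub>1 = k"
    and "k \<le> r" and "r \<le> min m n"
    and "sing_val (proj_perp A\<^sub>1 A\<^sub>2) (r - k) > sing_val (proj_perp A\<^sub>1 A\<^sub>2) (r - k + 1)"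
  shows "\<exists>A\<^sub>2'.
    (\<forall>X. is_arg_min (plain_cost A\<^sub>1 A\<^sub>2)
           (\<lambda>(X\<^sub>1, X\<^sub>2). (X\<^sub>1, X\<^sub>2) \<in> low_rank_pairs m k (n - k) r \<and> X\<^sub>1 = A\<^sub>1) X
         \<longleftrightarrow> X = (A\<^sub>1, A\<^sub>2')) \<and>
    (\<exists>C L. 0 < L \<and>
       (\<forall>W\<^sub>1 X\<^sub>1 X\<^sub>2.
          W\<^sub>1 \<in> carrier_mat m k \<longrightarrow>
          (\<forall>i<m. \<forall>j<k. 0 < W\<^sub>1 $$ (i, j)) \<longrightarrow>
          is_arg_min (weighted_cost A\<^sub>1 A\<^sub>2 W\<^sub>1 (all_ones m (n - k)))
            (\<lambda>X. X \<in> low_rank_pairs m k (n - k) r) (X\<^sub>1, X\<^sub>2) \<longrightarrow>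
          L \<le> min_entry W\<^sub>1 \<longrightarrow>
          frob_norm (append_cols X\<^sub>1 X\<^sub>2 - append_cols A\<^sub>1 A\<^sub>2') \<le> C / min_entry W\<^sub>1))"
proof -
  define l where "l = n - k"
  define q where "q = r - k"
  have r: "r = k + q" and q: "q \<le> l" using assms(5,6) by (auto simp: q_def l_def)
  note A1 = assms(1) and A2 = assms(2)[folded l_def]
  have inj: "mat_inj A\<^sub>1" by (rule mat_inj_if_full_rank[OF A1 assms(4)])
  obtain c T F G where c: "0 < c" and T: "T \<in> carrier_mat k l" and F: "F \<in> carrier_mat m q"
    and G: "G \<in> carrier_mat q l"
    and growth: "\<And>Z. Z \<in> carrier_mat m l \<Longrightarrow>
      (\<And>p C. C \<in> carrier_mat (k + l) p \<Longrightarrow> mat_inj (append_cols A\<^sub>1 Z * C) \<Longrightarrow> p \<le> k + q) \<Longrightarrow>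
      fip (A\<^sub>2 - (A\<^sub>1 * T + F * G)) (A\<^sub>2 - (A\<^sub>1 * T + F * G))
        + c * fip (Z - (A\<^sub>1 * T + F * G)) (Z - (A\<^sub>1 * T + F * G)) \<le> fip (A\<^sub>2 - Z) (A\<^sub>2 - Z)"
    using constrained_approximation[OF A1 A2 inj q assms(7)[folded q_def]] by blast
  define A2' where "A2' = A\<^sub>1 * T + F * G"
  have A2': "A2' \<in> carrier_mat m l" using A1 T F G by (simp add: A2'_def)
  define R where "R = A\<^sub>2 - A2'"
  have R: "R \<in> carrier_mat m l" using A2' by (auto simp: R_def intro: minus_carrier_mat)
  have nonneg: "0 \<le> fip X X" for X by (simp flip: frob_norm_square)

  have "is_arg_min (plain_cost A\<^sub>1 A\<^sub>2)
      (\<lambda>(X\<^sub>1, X\<^sub>2). (X\<^sub>1, X\<^sub>2) \<in> low_rank_pairs m k (n - k) r \<and> X\<^sub>1 = A\<^sub>1) X \<longleftrightarrow> X = (A\<^sub>1, A2')" for X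
  proof -
    let ?P = "\<lambda>(X\<^sub>1, X\<^sub>2). (X\<^sub>1, X\<^sub>2) \<in> low_rank_pairs m k (n - k) r \<and> X\<^sub>1 = A\<^sub>1"
    have P: "?P X \<longleftrightarrow> (\<exists>Z. X = (A\<^sub>1, Z) \<and> Z \<in> carrier_mat m l \<and> vec_space.rank m (append_cols A\<^sub>1 Z) \<le> r)" for X
      using A1 by (auto simp: low_rank_pairs_def l_def)
    have feasible: "?P (A\<^sub>1, A2')"
      unfolding P using A2' rank_append_cols_le[OF A1 T F G] by (simp add: A2'_def r)
    have cost: "fip R R + c * fip (Z - A2') (Z - A2') \<le> plain_cost A\<^sub>1 A\<^sub>2 (A\<^sub>1, Z)"
      if Z: "Z \<in> carrier_mat m l" and rk: "vec_space.rank m (append_cols A\<^sub>1 Z) \<le> r" for Z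
    proof -
      have AZ: "append_cols A\<^sub>1 Z \<in> carrier_mat m (k + l)" using A1 Z by simp
      have "p \<le> k + q" if "C \<in> carrier_mat (k + l) p" "mat_inj (append_cols A\<^sub>1 Z * C)" for p C
        using rank_mult_le[OF AZ that(1)] rank_mat_inj[OF _ that(2), of m p] AZ that(1) rk r by simp
      then show ?thesis
        unfolding plain_cost_same_first[OF A1 A2 Z] R_def A2'_def by (intro growth[OF Z]) auto
    qed
    have cost': "plain_cost A\<^sub>1 A\<^sub>2 (A\<^sub>1, A2') = fip R R"
      unfolding plain_cost_same_first[OF A1 A2 A2'] R_def ..
    show ?thesis
    proof
      assume arg: "is_arg_min (plain_cost A\<^sub>1 A\<^sub>2) ?P X"
      then obtain Z where X: "X = (A\<^sub>1, Z)" and Z: "Z \<in> carrier_mat m l"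
        and rk: "vec_space.rank m (append_cols A\<^sub>1 Z) \<le> r"
        using P unfolding is_arg_min_def by blast
      have "plain_cost A\<^sub>1 A\<^sub>2 (A\<^sub>1, Z) \<le> fip R R"
        using arg feasible unfolding is_arg_min_def X cost'[symmetric] not_less[symmetric] by blast
      then have "c * fip (Z - A2') (Z - A2') \<le> 0" using cost[OF Z rk] by simp
      then have "fip (Z - A2') (Z - A2') = 0"
        using c nonneg[of "Z - A2'"] by (simp add: mult_le_0_iff)
      then have "frob_norm (Z - A2') = 0" by (simp flip: frob_norm_square)
      then show "X = (A\<^sub>1, A2')" using mat_eq_if_frob_norm_diff_0[OF Z A2'] X by simp
    next
      assume X: "X = (A\<^sub>1, A2')"
      have "\<not> plain_cost A\<^sub>1 A\<^sub>2 y < plain_cost A\<^sub>1 A\<^sub>2 X" if "?P y" for y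
      proof -
        obtain Z where y: "y = (A\<^sub>1, Z)" and Z: "Z \<in> carrier_mat m l"
          and rk: "vec_space.rank m (append_cols A\<^sub>1 Z) \<le> r"
          using \<open>?P y\<close> P by blast
        have "0 \<le> c * fip (Z - A2') (Z - A2')" using c nonneg by simp
        then show ?thesis using cost[OF Z rk] cost' unfolding X y by simp
      qed
      then show "is_arg_min (plain_cost A\<^sub>1 A\<^sub>2) ?P X"
        using feasible unfolding is_arg_min_def X by blast
    qed
  qed
  moreover have "\<exists>C L. 0 < L \<and>
       (\<forall>W\<^sub>1 X\<^sub>1 X\<^sub>2.
          W\<^sub>1 \<in> carrier_mat m k \<longrightarrow>
          (\<forall>i<m. \<forall>j<k. 0 < W\<^sub>1 $$ (i, j)) \<longrightarrow>
          is_arg_min (weighted_cost A\<^sub>1 A\<^sub>2 W\<^sub>1 (all_ones m (n - k)))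
            (\<lambda>X. X \<in> low_rank_pairs m k (n - k) r) (X\<^sub>1, X\<^sub>2) \<longrightarrow>
          L \<le> min_entry W\<^sub>1 \<longrightarrow>
          frob_norm (append_cols X\<^sub>1 X\<^sub>2 - append_cols A\<^sub>1 A2') \<le> C / min_entry W\<^sub>1)"
  proof -
    obtain L where L: "L \<in> carrier_mat k m" and LA: "L * A\<^sub>1 = 1\<^sub>m k"
      using left_inverse_symmetric_projection[OF A1 inj] by blast
    define \<rho> where "\<rho> = frob_norm R"
    define \<alpha> where "\<alpha> = frob_norm L"
    define a where "a = frob_norm A2'"
    define b where "b = (4 * \<rho> + 6 * a) / c"
    \<comment> \<open>The smallness demanded by \<open>perturbation_bound\<close>. It also keeps the
      norm of \<open>E\<close> below 1, which makes \<open>S\<close> invertible.\<close>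
    define \<mu> where "\<mu> = min (1 / 2) (c / 4)"
    have nn: "0 \<le> \<rho>" "0 \<le> \<alpha>" "0 \<le> a" by (auto simp: \<rho>_def \<alpha>_def a_def)
    have b: "0 \<le> b" using nn c by (simp add: b_def)
    have \<mu>: "0 < \<mu>" "\<mu> \<le> 1 / 2" "\<mu> \<le> c / 4" using c by (auto simp: \<mu>_def)
    \<comment> \<open>The first summand comes from the first block, the second from \<epsilon> (2 b
      + a) with \<epsilon> = \<rho> \<alpha> / \<nu>. The threshold \<open>\<Lambda>\<close>
      enforces \<epsilon> \<le> \<mu>, and the maximum with 1 keeps it positive even if \<rho>
      \<alpha> = 0.\<close>
    define C where "C = \<rho> + \<rho> * \<alpha> * (2 * b + a)"
    define \<Lambda> where "\<Lambda> = max 1 (\<rho> * \<alpha> / \<mu>)"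
    show ?thesis
    proof (rule exI[of _ C], rule exI[of _ \<Lambda>], intro conjI allI impI)
      show "0 < \<Lambda>" by (simp add: \<Lambda>_def)
      fix W X1 X2
      assume W: "W \<in> carrier_mat m k"
        and arg: "is_arg_min (weighted_cost A\<^sub>1 A\<^sub>2 W (all_ones m (n - k)))
            (\<lambda>X. X \<in> low_rank_pairs m k (n - k) r) (X1, X2)"
        and large: "\<Lambda> \<le> min_entry W"
      define \<nu> where "\<nu> = min_entry W"
      have \<nu>: "0 < \<nu>" "\<rho> * \<alpha> / \<mu> \<le> \<nu>" using large by (auto simp: \<Lambda>_def \<nu>_def)
      define \<epsilon> where "\<epsilon> = \<rho> / \<nu> * \<alpha>"
      have \<epsilon>0: "0 \<le> \<epsilon>" using nn \<nu> by (simp add: \<epsilon>_def)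
      have "\<rho> * \<alpha> \<le> \<nu> * \<mu>" using \<nu>(2) \<mu>(1) by (simp only: pos_divide_le_eq)
      then have "\<rho> * \<alpha> / \<nu> \<le> \<mu>" using \<nu>(1) by (simp only: pos_divide_le_eq mult.commute)
      then have "\<epsilon> \<le> \<mu>" by (simp add: \<epsilon>_def)
      then have \<epsilon>: "\<epsilon> \<le> 1 / 2" "\<epsilon> \<le> c / 4" using \<mu> by auto
      have X1: "X1 \<in> carrier_mat m k" and X2: "X2 \<in> carrier_mat m l"
        and rkX: "vec_space.rank m (append_cols X1 X2) \<le> r"
        using arg by (auto simp: is_arg_min_def low_rank_pairs_def l_def)
      have opt: "weighted_cost A\<^sub>1 A\<^sub>2 W (all_ones m l) (X1, X2)
          \<le> weighted_cost A\<^sub>1 A\<^sub>2 W (all_ones m l) (Y1, Y2)"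
        if "Y1 \<in> carrier_mat m k" "Y2 \<in> carrier_mat m l" "vec_space.rank m (append_cols Y1 Y2) \<le> r" for Y1 Y2
        using arg that unfolding is_arg_min_def low_rank_pairs_def l_def[symmetric] by (auto simp: not_less)
      define \<Delta> where "\<Delta> = X1 - A\<^sub>1"
      have \<Delta>: "\<Delta> \<in> carrier_mat m k" using A1 by (auto simp: \<Delta>_def intro: minus_carrier_mat)
      \<comment> \<open>The pair \<open>(A\<^sub>1, A2')\<close> has a cost independent of the
        weights, since its first block is exact. The first block of the minimiser must pay for its
        deviation within that budget.\<close>
      have norm\<Delta>: "frob_norm \<Delta> \<le> \<rho> / \<nu>"
      proof -
        have "fip ((A\<^sub>1 - A\<^sub>1) \<odot>\<^sub>H W) ((A\<^sub>1 - A\<^sub>1) \<odot>\<^sub>H W) = 0"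
          using A1 W by (simp add: fip_def hadamard_def)
        then have "weighted_cost A\<^sub>1 A\<^sub>2 W (all_ones m l) (A\<^sub>1, A2') = \<rho>\<^sup>2"
          unfolding weighted_cost_ones[OF A1 A2 W A1 A2'] by (simp add: \<rho>_def R_def frob_norm_square)
        moreover have "weighted_cost A\<^sub>1 A\<^sub>2 W (all_ones m l) (X1, X2)
            \<le> weighted_cost A\<^sub>1 A\<^sub>2 W (all_ones m l) (A\<^sub>1, A2')"
          using opt[OF A1 A2'] rank_append_cols_le[OF A1 T F G] by (simp add: A2'_def r)
        ultimately have "fip ((A\<^sub>1 - X1) \<odot>\<^sub>H W) ((A\<^sub>1 - X1) \<odot>\<^sub>H W) \<le> \<rho>\<^sup>2"
          unfolding weighted_cost_ones[OF A1 A2 W X1 X2] using nonneg[of "A\<^sub>2 - X2"] by simp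
        moreover have "0 \<le> min_entry W" using \<nu>(1) unfolding \<nu>_def by (rule less_imp_le)
        ultimately have "(\<nu> * frob_norm (A\<^sub>1 - X1))\<^sup>2 \<le> \<rho>\<^sup>2"
          unfolding \<nu>_def
          using hadamard_min_entry_bound[OF minus_carrier_mat[OF X1] W, of A\<^sub>1] by (metis order_trans)
        then have "\<nu> * frob_norm (A\<^sub>1 - X1) \<le> \<rho>" by (rule power2_le_imp_le[OF _ nn(1)])
        then show ?thesis
          unfolding \<Delta>_def frob_norm_minus_commute[OF X1 A1] using \<nu>(1)
            by (simp only: pos_le_divide_eq mult.commute)
      qed
      \<comment> \<open>Because \<open>L\<close> is a left inverse of \<open>A\<^sub>1\<close>, the
        matrix \<open>E\<close> sends \<open>A\<^sub>1\<close> to \<open>\<Delta>\<close>, and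
        adding the identity sends it to \<open>X1\<close>.\<close>
      define E where "E = \<Delta> * L"
      have E: "E \<in> carrier_mat m m" using \<Delta> L by (simp add: E_def)
      have "frob_norm E \<le> frob_norm \<Delta> * \<alpha>" unfolding E_def \<alpha>_def by (rule frob_norm_mult[OF \<Delta> L])
      also have "\<dots> \<le> \<epsilon>" unfolding \<epsilon>_def by (rule mult_right_mono[OF norm\<Delta> nn(2)])
      finally have normE: "frob_norm E \<le> \<epsilon>" .
      define S where "S = 1\<^sub>m m + E"
      have S: "S \<in> carrier_mat m m" using E by (simp add: S_def)
      have Sinj: "mat_inj S" unfolding S_def using normE \<epsilon> by (intro mat_inj_one_plus_small[OF E]) simp
      obtain S' where S': "S' \<in> carrier_mat m m" and SS': "S * S' = 1\<^sub>m m"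
        using mat_inj_invertible[OF S Sinj] by blast
      have S_mult: "S * M = M + E * M" if "M \<in> carrier_mat m p" for M p
        using that E by (simp add: S_def add_mult_distrib_mat[of _ m m])
      have SA: "S * A\<^sub>1 = X1"
      proof -
        have "E * A\<^sub>1 = \<Delta>" using \<Delta> L A1 LA by (simp add: E_def assoc_mult_mat[of \<Delta> m k L m A\<^sub>1 k])
        then have "S * A\<^sub>1 = A\<^sub>1 + (X1 - A\<^sub>1)" unfolding S_mult[OF A1] \<Delta>_def by simp
        also have "\<dots> = X1" using A1 X1 by (intro eq_matI) auto
        finally show ?thesis .
      qed
      define Z where "Z = S' * X2"
      have Z: "Z \<in> carrier_mat m l" using S' X2 by (simp add: Z_def)
      have SZ: "S * Z = X2"
      proof -
        have "S * Z = S * S' * X2" unfolding Z_def using S S' X2 by (intro assoc_mult_mat[symmetric])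
        then show ?thesis using X2 unfolding SS' by simp
      qed
      define D where "D = Z - A2'"
      have D: "D \<in> carrier_mat m l" using A2' by (auto simp: D_def intro: minus_carrier_mat)
      define M where "M = E * A2'"
      define K where "K = E * D"
      have M: "M \<in> carrier_mat m l" and K: "K \<in> carrier_mat m l" using E A2' D by (auto simp: M_def K_def)
      have A2Z: "A\<^sub>2 - Z = R - D"
        unfolding R_def D_def using A2 A2' Z by (intro eq_matI) auto
      have growthD: "fip R R + c * fip D D \<le> fip (R - D) (R - D)"
      proof -
        have AZ: "append_cols A\<^sub>1 Z \<in> carrier_mat m (k + l)" using A1 Z by simp
        have "p \<le> k + q" if "C \<in> carrier_mat (k + l) p" "mat_inj (append_cols A\<^sub>1 Z * C)" for p C
          using inj_factor_le_rank[OF S Sinj AZ that] rkX r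
          unfolding mult_append_cols[OF S A1 Z] SA SZ by simp
        then have "fip R R + c * fip D D \<le> fip (A\<^sub>2 - Z) (A\<^sub>2 - Z)"
          unfolding R_def D_def A2'_def by (intro growth[OF Z]) auto
        then show ?thesis unfolding A2Z .
      qed
      have X2_eq: "X2 = A2' + D + (M + K)"
      proof -
        have "E * Z = M + K"
          unfolding M_def K_def mult_add_distrib_mat[OF E A2' D, symmetric]
          using A2' Z by (intro arg_cong[of _ _ "\<lambda>X. E * X"] eq_matI) (auto simp: D_def)
        moreover have "Z = A2' + D" using A2' Z by (intro eq_matI) (auto simp: D_def)
        ultimately show ?thesis using S_mult[OF Z] SZ by simp
      qed
      \<comment> \<open>Multiplying \<open>A2'\<close> by \<open>S\<close> turns
        \<open>A\<^sub>1 * T\<close> into \<open>X1 * T\<close>, so \<open>(X1, S * A2')\<close>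
        respects the rank bound. Its first block is that of the minimiser, and the weighted terms
        drop out.\<close>
      have optD: "fip (R - D - (M + K)) (R - D - (M + K)) \<le> fip (R - M) (R - M)"
      proof -
        have "S * A2' = X1 * T + S * F * G"
        proof -
          have "S * A2' = S * (A\<^sub>1 * T) + S * (F * G)"
            unfolding A2'_def using S A1 T F G by (intro mult_add_distrib_mat[of _ m m _ l]) auto
          also have "S * (A\<^sub>1 * T) = X1 * T"
            unfolding SA[symmetric] using S A1 T by (intro assoc_mult_mat[symmetric])
          also have "S * (F * G) = S * F * G" using S F G by (intro assoc_mult_mat[symmetric])
          finally show ?thesis .
        qed
        then have "vec_space.rank m (append_cols X1 (S * A2')) \<le> r"
          using rank_append_cols_le[OF X1 T mult_carrier_mat[OF S F] G] r by simp
        moreover have SA2': "S * A2' \<in> carrier_mat m l" using S A2' by simp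
        ultimately have "fip (A\<^sub>2 - X2) (A\<^sub>2 - X2) \<le> fip (A\<^sub>2 - S * A2') (A\<^sub>2 - S * A2')"
          using opt[OF X1 SA2'] unfolding weighted_cost_ones[OF A1 A2 W X1 X2]
            weighted_cost_ones[OF A1 A2 W X1 SA2'] by simp
        moreover have "A\<^sub>2 - X2 = R - D - (M + K)"
          unfolding X2_eq R_def using A2 A2' D M K by (intro eq_matI) auto
        moreover have "A\<^sub>2 - S * A2' = R - M"
          unfolding S_mult[OF A2'] M_def[symmetric] R_def using A2 A2' M by (intro eq_matI) auto
        ultimately show ?thesis by simp
      qed
      have normM: "frob_norm M \<le> \<epsilon> * a"
      proof -
        have "frob_norm M \<le> frob_norm E * a" unfolding M_def a_def by (rule frob_norm_mult[OF E A2'])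
        also have "\<dots> \<le> \<epsilon> * a" using normE nn by (intro mult_right_mono)
        finally show ?thesis .
      qed
      have normK: "frob_norm K \<le> \<epsilon> * frob_norm D"
      proof -
        have "frob_norm K \<le> frob_norm E * frob_norm D" unfolding K_def by (rule frob_norm_mult[OF E D])
        also have "\<dots> \<le> \<epsilon> * frob_norm D" using normE by (intro mult_right_mono) auto
        finally show ?thesis .
      qed
      have normD: "frob_norm D \<le> \<epsilon> * b"
        using perturbation_bound[OF R D M K c growthD optD normM normK \<epsilon>0 \<epsilon> nn(3)]
        by (simp add: b_def \<rho>_def)
      have diff2: "X2 - A2' = D + (M + K)"
        unfolding X2_eq using A2' D M K by (intro eq_matI) auto
      have "frob_norm (X2 - A2') \<le> frob_norm D + (frob_norm M + frob_norm K)"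
        unfolding diff2 using frob_norm_triangle[OF D, of "M + K"] frob_norm_triangle[OF M K] M K by simp
      \<comment> \<open>Since \<epsilon> \<le> 1 / 2, the bound on \<open>K\<close> is half the
        bound on \<open>D\<close>; the resulting 3 b / 2 is rounded up to 2 b.\<close>
      also have "\<dots> \<le> \<epsilon> * b + (\<epsilon> * a + 1 / 2 * (\<epsilon> * b))"
        using normD normM normK mult_mono[OF \<epsilon>(1) normD] b \<epsilon>0 by simp
      also have "\<dots> \<le> \<epsilon> * (2 * b + a)" using b \<epsilon>0 by (simp add: algebra_simps)
      finally have norm2: "frob_norm (X2 - A2') \<le> \<epsilon> * (2 * b + a)" .
      have N: "\<Delta> \<in> carrier_mat m k" "X2 - A2' \<in> carrier_mat m l"
        using \<Delta> A2' by (auto intro: minus_carrier_mat)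
      have "(frob_norm (append_cols X1 X2 - append_cols A\<^sub>1 A2'))\<^sup>2
          = (frob_norm \<Delta>)\<^sup>2 + (frob_norm (X2 - A2'))\<^sup>2"
        unfolding append_cols_diff[OF X1 X2 A1 A2'] \<Delta>_def[symmetric] frob_norm_square
        by (rule fip_append_cols[OF N])
      also have "\<dots> \<le> (frob_norm \<Delta> + frob_norm (X2 - A2'))\<^sup>2" by (simp add: power2_sum)
      finally have "frob_norm (append_cols X1 X2 - append_cols A\<^sub>1 A2')
          \<le> frob_norm \<Delta> + frob_norm (X2 - A2')"
        by (rule power2_le_imp_le) simp
      also have "\<dots> \<le> \<rho> / \<nu> + \<rho> / \<nu> * \<alpha> * (2 * b + a)"
        using norm\<Delta> norm2 by (simp add: \<epsilon>_def)
      also have "\<dots> = C / \<nu>" by (simp add: C_def add_divide_distrib)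
      finally show "frob_norm (append_cols X1 X2 - append_cols A\<^sub>1 A2') \<le> C / min_entry W"
        unfolding \<nu>_def .
    qed
  qed
  ultimately show ?thesis by blast
qed

end
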